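(* Let $K\in\mathbb{N}$ with $K>2$ and $4K\le n\le p$, and let $\mathscr{S}:M_{n\times p}\to\mathbb{C}^m$ be a surjective linear map whose restricted isometry constants $\delta_{3K},\delta_{4K}$ satisfy $\delta_{3K}<1$ and $$\eta:=\frac{\sqrt2\,\delta_{4K}}{1-\delta_{3K}}<1-\frac{2}{K-2}.$$ Let $\mathscr{M}\in\mathbb{C}^m$ and consider the IRLS-M algorithm (defined in the context) with parameters $\gamma=1/n$ and $K$. If there exists a matrix $X\in M_{n\times p}$ of rank at most $k$ satisfying $\mathscr{S}(X)=\mathscr{M}$, where $k<K-\frac{2\eta}{1-\eta}$, then the sequence $(X^\ell)_{\ell\in\mathbb{N}}$ produced by the algorithm converges to $X$.
   Context: $M_{n\times p}$ is the space of complex $n\times p$ matrices with Frobenius norm $\|\cdot\|_F$. For $X\in M_{n\times p}$, $n\le p$, $\sigma_1(X)\ge\dots\ge\sigma_n(X)\ge0$ are its singular values. Restricted isometry constants: for a linear map $\mathscr{S}:M_{n\times p}\to\mathbb{C}^m$ and an integer $1\le k\le n$, $\delta_k=\delta_k(\mathscr{S})>0$ is the smallest number such that $(1-\delta_k)\|X\|_F^2\le\|\mathscr{S}(X)\|_{\ell_2^m}^2\le(1+\delta_k)\|X\|_F^2$ for all $X\in M_{n\times p}$ of rank at most $k$. IRLS-M algorithm (input: linear map $\mathscr{S}:M_{n\times p}\to\mathbb{C}^m$, data $\mathscr{M}\in\mathbb{C}^m$, parameters $K\in\mathbb{N}$, $\gamma>0$): Set $W^0=I\in M_{n\times n}$,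 $\varepsilon_0=1$. For $\ell=1,2,\dots$ define $$X^\ell:=\arg\min_{\mathscr{S}(X)=\mathscr{M}}\|(W^{\ell-1})^{1/2}X\|_F^2,\qquad \varepsilon_\ell:=\min\{\varepsilon_{\ell-1},\gamma\,\sigma_{K+1}(X^\ell)\}.$$ If $\varepsilon_\ell=0$ the algorithm stops, and one sets $X^j:=X^\ell$ for $j>\ell$. Otherwise, write $X^\ell(X^\ell)^*=U^\ell(\Sigma^\ell)^2(U^\ell)^*$ with $U^\ell\in M_{n\times n}$ unitary and $\Sigma^\ell=\operatorname{diag}(\sigma_1(X^\ell),\dots,\sigma_n(X^\ell))$, and set $$W^\ell:=U^\ell\,\operatorname{diag}\big(\max\{\sigma_j(X^\ell),\varepsilon_\ell\}\big)^{-1}(U^\ell)^*.$$ *)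

theory Defs
  imports "HOL-Analysis.Analysis" "HOL-Library.Multiset"
begin

(* A complex n x p matrix is an element of complex^'p^'n, with n = CARD('n) and p = CARD('p).
   The library norm on this type, the iterated Euclidean norm, is the Frobenius norm. *)

definition conj_transpose :: "complex^'p^'n \<Rightarrow> complex^'n^'p" where
  "conj_transpose A = (\<chi> i j. cnj (A $ j $ i))"

definition unitary :: "complex^'n^'n \<Rightarrow> bool" where
  "unitary U \<longleftrightarrow> conj_transpose U ** U = mat 1 \<and> U ** conj_transpose U = mat 1"

definition diag_matrix :: "('n \<Rightarrow> real) \<Rightarrow> complex^'n^'n" where
  "diag_matrix d = (\<chi> i j. if i = j then complex_of_real (d i) else 0)"

(* The inner product here is the real one of the library, which on complex^'n is
   the real part of the Hermitian inner product. *)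
definition pos_semidef :: "complex^'n^'n \<Rightarrow> bool" where
  "pos_semidef A \<longleftrightarrow> conj_transpose A = A \<and> (\<forall>v. 0 \<le> v \<bullet> (A *v v))"

definition matrix_sqrt :: "complex^'n^'n \<Rightarrow> complex^'n^'n" where
  "matrix_sqrt W = (THE B. pos_semidef B \<and> B ** B = W)"

(* X X^* = U diag(d)^2 U^* with U unitary and d >= 0. The index type 'n carries no order, so d
   lists the n singular values of X, with multiplicity, in an arbitrary order (a reordering of
   d amounts to a permutation of the columns of U). *)
definition left_singular_decomp ::
    "complex^'p^'n \<Rightarrow> complex^'n^'n \<Rightarrow> ('n \<Rightarrow> real) \<Rightarrow> bool" where
  "left_singular_decomp X U d \<longleftrightarrow> unitary U \<and> (\<forall>i. 0 \<le> d i) \<and>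
     X ** conj_transpose X = U ** (diag_matrix d ** diag_matrix d) ** conj_transpose U"

definition singular_values :: "complex^'p^'n \<Rightarrow> real multiset" where
  "singular_values X =
     (THE s. \<exists>U d. left_singular_decomp X U d \<and> s = image_mset d (mset_set UNIV))"

(* The j-th largest singular value, counted from j = 1 up to j = CARD('n). *)
definition singular_value :: "nat \<Rightarrow> complex^'p^'n \<Rightarrow> real" where
  "singular_value j X = rev (sorted_list_of_multiset (singular_values X)) ! (j - 1)"

definition complex_linear :: "(complex^'p^'n \<Rightarrow> complex^'m) \<Rightarrow> bool" where
  "complex_linear S \<longleftrightarrow> Vector_Spaces.linear (\<lambda>c. map_matrix ((*) c)) (*s) S"

(* For k >= 1 the infimum is attained. It ranges over nonnegative numbers because the constant
   is 0 when S preserves the norm of every matrix of rank at most k. *)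
definition ric :: "(complex^'p^'n \<Rightarrow> complex^'m) \<Rightarrow> nat \<Rightarrow> real" where
  "ric S k = Inf {\<delta>. 0 \<le> \<delta> \<and> (\<forall>X. rank X \<le> k \<longrightarrow>
     (1 - \<delta>) * (norm X)\<^sup>2 \<le> (norm (S X))\<^sup>2 \<and> (norm (S X))\<^sup>2 \<le> (1 + \<delta>) * (norm X)\<^sup>2)}"

definition weighted_minimizer ::
    "(complex^'p^'n \<Rightarrow> complex^'m) \<Rightarrow> complex^'m \<Rightarrow> complex^'n^'n \<Rightarrow> complex^'p^'n" where
  "weighted_minimizer S M W = arg_min (\<lambda>X. (norm (matrix_sqrt W ** X))\<^sup>2) (\<lambda>X. S X = M)"

(* For \<epsilon> > 0 the matrix described does not depend on the choice of U and d. *)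
definition irls_weight :: "complex^'p^'n \<Rightarrow> real \<Rightarrow> complex^'n^'n" where
  "irls_weight X \<epsilon> = (THE W. \<exists>U d. left_singular_decomp X U d \<and>
     W = U ** diag_matrix (\<lambda>i. inverse (max (d i) \<epsilon>)) ** conj_transpose U)"

(* State (X^l, W^l, \<epsilon>_l) after l steps. There is no X^0 in the algorithm: the component 0 of the
   initial state is a placeholder that is never read. After stopping (\<epsilon>_l = 0) the state is
   frozen, and its weight component is never read. *)
fun irls_state :: "(complex^'p^'n \<Rightarrow> complex^'m) \<Rightarrow> complex^'m \<Rightarrow> nat \<Rightarrow> real \<Rightarrow>
    nat \<Rightarrow> (complex^'p^'n) \<times> (complex^'n^'n) \<times> real" where
  "irls_state S M K \<gamma> 0 = (0, mat 1, 1)"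
| "irls_state S M K \<gamma> (Suc l) =
     (case irls_state S M K \<gamma> l of (X, W, \<epsilon>) \<Rightarrow>
        if \<epsilon> = 0 then (X, W, \<epsilon>)
        else let X' = weighted_minimizer S M W;
                 \<epsilon>' = min \<epsilon> (\<gamma> * singular_value (K + 1) X')
             in (X', irls_weight X' \<epsilon>', \<epsilon>'))"

definition irls_iterate :: "(complex^'p^'n \<Rightarrow> complex^'m) \<Rightarrow> complex^'m \<Rightarrow> nat \<Rightarrow> real \<Rightarrow>
    nat \<Rightarrow> complex^'p^'n" where
  "irls_iterate S M K \<gamma> l = fst (irls_state S M K \<gamma> l)"

end

theory Submission
  imports Defs
begin

text \<open>The iterates decrease \<open>J\<^sub>\<epsilon>(X)\<close>, the sum of \<open>h\<^sub>\<epsilon>(\<sigma>\<^sub>i(X))\<close> with \<open>h\<^sub>\<epsilon>\<close> the Huber function: \<open>J\<^sub>\<epsilon>\<close> is the minimum over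
  weights \<open>0 < W \<le> \<epsilon>\<^sup>-\<^sup>1 I\<close> of \<open>(\<langle>X, W X\<rangle> + tr W\<^sup>-\<^sup>1) / 2\<close>, attained at the weight chosen by the algorithm.
  The restricted isometry property gives \<open>\<parallel>Z - X\<parallel> \<le> \<kappa> (\<parallel>Z\<parallel>\<^sub>* - \<parallel>X\<parallel>\<^sub>*)\<close> for every feasible \<open>Z\<close>.
  If \<open>\<epsilon>\<^sub>l\<close> tends to 0, then, at each step at which it drops, \<open>\<sigma>\<^bsub>K+1\<^esub>\<close> of the iterate is \<open>n \<epsilon>\<^sub>l\<close>, so that the iterate is
  \<open>O(\<epsilon>\<^sub>l)\<close>-close to \<open>X\<close>; by monotonicity \<open>J \<le> \<parallel>X\<parallel>\<^sub>* + O(\<epsilon>\<^sub>l)\<close> at all later steps, and stability yields convergence.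
  If \<open>\<epsilon>\<^sub>l\<close> stayed away from 0, then consecutive iterates would approach each other, so that by convexity they
  would almost minimize \<open>J\<^sub>\<epsilon>\<close>. Hence \<open>\<parallel>Z\<parallel>\<^sub>* - \<parallel>X\<parallel>\<^sub>* \<le> n \<epsilon>\<^sub>l \<le> \<sigma>\<^bsub>K+1\<^esub>(Z)\<close> for some iterate \<open>Z\<close>, and stability contradicts
  the Eckart--Young bound \<open>(K + 1 - k) \<sigma>\<^bsub>K+1\<^esub>(Z)\<^sup>2 \<le> \<parallel>Z - X\<parallel>\<^sup>2\<close>.

  No right singular vectors are used: the rows of \<open>U\<^sup>* X\<close>, with \<open>U\<close> unitary and \<open>X X\<^sup>* = U D\<^sup>2 U\<^sup>*\<close>, are
  orthogonal with the singular values as norms.\<close>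

section \<open>Complex matrices\<close>

abbreviation ct :: "complex^'p^'n \<Rightarrow> complex^'n^'p" where
  "ct \<equiv> conj_transpose"

lemma ct_nth [simp]: "ct A $ i $ j = cnj (A $ j $ i)"
  by (simp add: conj_transpose_def)

lemma ct_ct [simp]: "ct (ct A) = A"
  by (simp add: vec_eq_iff)

lemma ct_mult: "ct (A ** B) = ct B ** ct A"
  by (simp add: vec_eq_iff matrix_matrix_mult_def mult.commute)

lemma ct_add: "ct (A + B) = ct A + ct B"
  by (simp add: vec_eq_iff)

lemma ct_diff: "ct (A - B) = ct A - ct B"
  by (simp add: vec_eq_iff)

lemma ct_0 [simp]: "ct 0 = 0"
  by (simp add: vec_eq_iff)

lemma ct_mat_1 [simp]: "ct (mat 1) = mat 1"
  by (auto simp: vec_eq_iff mat_def)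

lemma ct_diag [simp]: "ct (diag_matrix d) = diag_matrix d"
  by (auto simp: vec_eq_iff diag_matrix_def)

lemma diag_nth: "diag_matrix d $ i $ j = (if i = j then complex_of_real (d i) else 0)"
  by (simp add: diag_matrix_def)

lemma diag_mult_nth: "(diag_matrix d ** A) $ i $ j = complex_of_real (d i) * A $ i $ j"
  by (simp add: matrix_matrix_mult_def diag_matrix_def if_distrib[of "\<lambda>x. x * _"] cong: if_cong)

lemma mult_diag_nth: "(A ** diag_matrix d) $ i $ j = A $ i $ j * complex_of_real (d j)"
  by (simp add: matrix_matrix_mult_def diag_matrix_def if_distrib[of "\<lambda>x. _ * x"] cong: if_cong)

lemma diag_mult_row: "(diag_matrix d ** A) $ i = d i *\<^sub>R A $ i"
  by (simp only: vec_eq_iff diag_mult_nth vector_scaleR_component) (simp add: scaleR_conv_of_real)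

lemma diag_mult_diag: "diag_matrix a ** diag_matrix b = diag_matrix (\<lambda>i. a i * b i)"
  by (simp add: vec_eq_iff diag_mult_nth diag_nth)

lemma diag_1: "diag_matrix (\<lambda>i. 1) = mat 1"
  by (auto simp: vec_eq_iff diag_nth mat_def)

lemma matrix_diff_ldistrib: "A ** (B - C) = A ** B - A ** (C :: 'a::comm_ring_1^'p^'n)"
  by (simp add: vec_eq_iff matrix_matrix_mult_def algebra_simps sum_subtractf)

lemma matrix_add_rdistrib: "(B + C) ** A = B ** A + (C :: 'a::comm_ring_1^'p^'n) ** A"
  by (simp add: vec_eq_iff matrix_matrix_mult_def algebra_simps sum.distrib)

lemma matrix_diff_rdistrib: "(B - C) ** A = B ** A - (C :: 'a::comm_ring_1^'p^'n) ** A"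
  by (simp add: vec_eq_iff matrix_matrix_mult_def algebra_simps sum_subtractf)

lemma matrix_zero_left [simp]: "0 ** A = (0 :: 'a::comm_ring_1^'p^'n)"
  by (simp add: vec_eq_iff matrix_matrix_mult_def)

lemma matrix_zero_right [simp]: "A ** 0 = (0 :: 'a::comm_ring_1^'p^'n)"
  by (simp add: vec_eq_iff matrix_matrix_mult_def)

lemmas matrix_distribs = matrix_diff_ldistrib matrix_add_ldistrib matrix_add_rdistrib matrix_diff_rdistrib

lemma matrix_mult_scaleR: "A ** (c *\<^sub>R B) = c *\<^sub>R (A ** (B :: complex^'p^'n))"
  by (simp add: vec_eq_iff matrix_matrix_mult_def scaleR_sum_right)

section \<open>The real inner product of matrices, adjoints and row norms\<close>

lemma inner_matrix_eq: "X \<bullet> Y = (\<Sum>i\<in>UNIV. \<Sum>j\<in>UNIV. Re (X $ i $ j * cnj (Y $ i $ j)))"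
  for X Y :: "complex^'p^'n"
  by (simp add: inner_vec_def inner_complex_def)

lemma inner_mult_left: "(A ** X) \<bullet> Y = X \<bullet> (ct A ** Y)"
  for X :: "complex^'p^'n" and A :: "complex^'n^'m"
proof -
  have "(A ** X) \<bullet> Y = (\<Sum>i\<in>UNIV. \<Sum>j\<in>UNIV. \<Sum>k\<in>UNIV. Re (A$i$k * X$k$j * cnj (Y$i$j)))"
    by (simp add: inner_matrix_eq matrix_matrix_mult_def sum_distrib_right)
  also have "\<dots> = (\<Sum>k\<in>UNIV. \<Sum>j\<in>UNIV. \<Sum>i\<in>UNIV. Re (A$i$k * X$k$j * cnj (Y$i$j)))"
  proof -
    have "(\<Sum>i\<in>UNIV. \<Sum>j\<in>UNIV. \<Sum>k\<in>UNIV. f i j k) = (\<Sum>k\<in>UNIV. \<Sum>j\<in>UNIV. \<Sum>i\<in>UNIV. f i j k)"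
      for f :: "'m \<Rightarrow> 'p \<Rightarrow> 'n \<Rightarrow> real"
    proof -
      have "(\<Sum>i\<in>UNIV. \<Sum>j\<in>UNIV. \<Sum>k\<in>UNIV. f i j k) = (\<Sum>j\<in>UNIV. \<Sum>i\<in>UNIV. \<Sum>k\<in>UNIV. f i j k)"
        by (rule sum.swap)
      also have "\<dots> = (\<Sum>j\<in>UNIV. \<Sum>k\<in>UNIV. \<Sum>i\<in>UNIV. f i j k)"
        by (intro sum.cong refl sum.swap)
      also have "\<dots> = (\<Sum>k\<in>UNIV. \<Sum>j\<in>UNIV. \<Sum>i\<in>UNIV. f i j k)"
        by (rule sum.swap)
      finally show ?thesis .
    qed
    then show ?thesis .
  qed
  also have "\<dots> = X \<bullet> (ct A ** Y)"
    by (simp add: inner_matrix_eq matrix_matrix_mult_def sum_distrib_left algebra_simps)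
  finally show ?thesis .
qed

lemma inner_ct: "ct X \<bullet> ct Y = X \<bullet> Y"
  unfolding inner_matrix_eq by (subst sum.swap) simp

lemma inner_mult_right: "(X ** A) \<bullet> Y = X \<bullet> (Y ** ct A)"
  for X :: "complex^'p^'n" and A :: "complex^'m^'p"
proof -
  have "(X ** A) \<bullet> Y = (ct A ** ct X) \<bullet> ct Y" by (simp only: inner_ct[symmetric, of "X ** A"] ct_mult)
  also have "\<dots> = ct X \<bullet> ct (Y ** ct A)" by (simp only: inner_mult_left ct_mult ct_ct)
  finally show ?thesis by (simp only: inner_ct)
qed

lemma norm_sq_rows: "(norm X)\<^sup>2 = (\<Sum>i\<in>UNIV. (norm (X $ i))\<^sup>2)" for X :: "'a::real_inner^'n"
  by (simp add: power2_norm_eq_inner inner_vec_def)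

lemma norm_sq_row: "(norm v)\<^sup>2 = (\<Sum>j\<in>UNIV. (norm (v $ j))\<^sup>2)" for v :: "complex^'p"
  by (rule norm_sq_rows)

lemma mult_ct_diag: "(Y ** ct Y) $ i $ i = of_real ((norm (Y $ i))\<^sup>2)"
  by (simp add: matrix_matrix_mult_def norm_sq_row complex_norm_square del: of_real_power)

text \<open>The diagonal of a Gram matrix carries the squared row norms. \<open>Y\<close> and
  \<open>Z\<close> may differ in width, so the rows of a wide matrix can be measured on a narrower
  one with the same Gram matrix.\<close>

lemma gram_row_norm:
  assumes "Y ** ct Y = Z ** ct Z" shows "norm (Y $ i) = norm (Z $ i)"
proof -
  have "of_real ((norm (Y $ i))\<^sup>2) = (of_real ((norm (Z $ i))\<^sup>2) :: complex)"
    using assms by (metis mult_ct_diag)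
  then have "(norm (Y $ i))\<^sup>2 = (norm (Z $ i))\<^sup>2"
    using of_real_eq_iff by blast
  then show ?thesis by simp
qed

section \<open>Unitary matrices\<close>

lemma unitary_ct: "unitary U \<Longrightarrow> unitary (ct U)"
  by (simp add: unitary_def)

lemma unitary_mat_1: "unitary (mat 1)"
  by (simp add: unitary_def)

lemma unitary_cancel:
  assumes "unitary U"
  shows "ct U ** (U ** A) = A" "U ** (ct U ** A) = A" "(B ** U) ** ct U = B" "(B ** ct U) ** U = B"
  using assms unfolding unitary_def by (metis matrix_mul_assoc matrix_mul_lid matrix_mul_rid)+

lemma unitary_mult: "unitary U \<Longrightarrow> unitary V \<Longrightarrow> unitary (U ** V)"
  by (simp add: unitary_def[of "U ** V"] ct_mult matrix_mul_assoc unitary_cancel)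
     (simp add: unitary_def)

lemma unitary_row_norm: "unitary U \<Longrightarrow> norm (U $ i) = 1"
proof -
  assume "unitary U"
  then have "of_real ((norm (U $ i))\<^sup>2) = (1 :: complex)"
    using mult_ct_diag[of U i] by (simp add: unitary_def mat_def)
  then have "(norm (U $ i))\<^sup>2 = 1"
    using of_real_eq_1_iff by blast
  then show ?thesis by (simp add: power2_eq_1_iff) (smt (verit) norm_ge_zero)
qed

lemma unitary_row_sum: "unitary U \<Longrightarrow> (\<Sum>j\<in>UNIV. (norm (U $ i $ j))\<^sup>2) = 1"
  using unitary_row_norm[of U i] norm_sq_row[of "U $ i"] by simp

lemma unitary_col_sum: "unitary U \<Longrightarrow> (\<Sum>i\<in>UNIV. (norm (U $ i $ j))\<^sup>2) = 1"
  using unitary_row_sum[of "ct U" j] unitary_ct[of U] by simp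

lemma norm_mult_unitary_left: "unitary U \<Longrightarrow> norm (U ** X) = norm X"
  by (simp add: norm_eq_sqrt_inner inner_mult_left unitary_cancel)

section \<open>Row norms from a left singular decomposition\<close>

lemma left_singular_decompD:
  assumes "left_singular_decomp X U d"
  shows "unitary U" "\<And>i. 0 \<le> d i"
    "X ** ct X = U ** diag_matrix (\<lambda>i. (d i)\<^sup>2) ** ct U"
  using assms by (auto simp: left_singular_decomp_def diag_mult_diag power2_eq_square)

text \<open>\<open>A ** X\<close> has the same Gram matrix as
  \<open>A ** U ** diag_matrix d\<close>, whose rows are explicit. This is the substitute for right
  singular vectors.\<close>

lemma row_norm_mult:
  fixes A :: "complex^'n^'m" and X :: "complex^'p^'n"
  assumes "left_singular_decomp X U d"
  shows "(norm ((A ** X) $ i))\<^sup>2 = (\<Sum>j\<in>UNIV. (norm ((A ** U) $ i $ j))\<^sup>2 * (d j)\<^sup>2)"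
proof -
  have "(A ** X) ** ct (A ** X) = A ** (X ** ct X) ** ct A"
    by (simp add: ct_mult matrix_mul_assoc)
  also have "\<dots> = (A ** U ** diag_matrix d) ** ct (A ** U ** diag_matrix d)"
    using assms by (simp add: left_singular_decomp_def ct_mult matrix_mul_assoc)
  finally have "norm ((A ** X) $ i) = norm ((A ** U ** diag_matrix d) $ i)"
    by (rule gram_row_norm)
  then show ?thesis
    by (simp add: norm_sq_row mult_diag_nth norm_mult power_mult_distrib)
qed

text \<open>The case \<open>A = ct U\<close> of \<open>row_norm_mult\<close>, where
  \<open>A ** U\<close> is the identity.\<close>

lemma row_norm_decomp:
  assumes "left_singular_decomp X U d" shows "norm ((ct U ** X) $ i) = d i"
proof -
  have "(norm ((ct U ** X) $ i))\<^sup>2 = (\<Sum>j\<in>UNIV. (if j = i then (d i)\<^sup>2 else 0))"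
    using assms unfolding row_norm_mult[OF assms]
    by (intro sum.cong) (auto simp: left_singular_decomp_def unitary_def mat_def)
  then have "(norm ((ct U ** X) $ i))\<^sup>2 = (d i)\<^sup>2" by simp
  then show ?thesis using left_singular_decompD(2)[OF assms, of i] by simp
qed

lemma norm_sq_decomp:
  assumes "left_singular_decomp X U d" shows "(norm X)\<^sup>2 = (\<Sum>i\<in>UNIV. (d i)\<^sup>2)"
  using row_norm_decomp[OF assms] norm_sq_rows[of "ct U ** X"]
    norm_mult_unitary_left[OF unitary_ct[OF left_singular_decompD(1)[OF assms]], of X]
  by simp

section \<open>Diagonalization of Hermitian matrices\<close>

lemma inner_complex_vector: "x \<bullet> y = Re (\<Sum>i\<in>UNIV. x $ i * cnj (y $ i))" for x y :: "complex^'n"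
  by (simp add: inner_vec_def inner_complex_def)

lemma inner_matrix_vector_left: "(A *v x) \<bullet> y = x \<bullet> (ct A *v y)" for A :: "complex^'n^'m"
proof -
  have "(A *v x) \<bullet> y = Re (\<Sum>i\<in>UNIV. \<Sum>j\<in>UNIV. A$i$j * x$j * cnj (y$i))"
    by (simp only: inner_complex_vector matrix_vector_mult_def vec_lambda_beta sum_distrib_right)
  also have "\<dots> = Re (\<Sum>j\<in>UNIV. \<Sum>i\<in>UNIV. A$i$j * x$j * cnj (y$i))"
    by (subst sum.swap) (rule refl)
  also have "\<dots> = x \<bullet> (ct A *v y)"
    by (simp only: inner_complex_vector matrix_vector_mult_def vec_lambda_beta sum_distrib_left
        ct_nth cnj_sum complex_cnj_mult complex_cnj_cnj mult_ac)
  finally show ?thesis .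
qed

lemma complex_matrix_vector_scaleR: "A *v (c *\<^sub>R x) = c *\<^sub>R (A *v x)" for A :: "complex^'n^'m"
  by (simp add: vec_eq_iff matrix_vector_mult_def scaleR_sum_right)

text \<open>The maximum \<open>l\<close> of the Rayleigh quotient on \<open>V\<close> makes \<open>x \<mapsto> l \<parallel>x\<parallel>\<^sup>2 - x \<bullet> A x\<close>
  positive semidefinite on \<open>V\<close>, and a positive semidefinite form has every isotropic vector in its kernel.\<close>

lemma hermitian_eigenvector_in_invariant_subspace:
  fixes A :: "complex^'n^'n" and V :: "(complex^'n) set"
  assumes A: "ct A = A" and V: "subspace V" "closed V" "\<And>x. x \<in> V \<Longrightarrow> A *v x \<in> V" and "x0 \<in> V" "x0 \<noteq> 0"
  obtains v l where "v \<in> V" "norm v = 1" "A *v v = l *\<^sub>R v"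
proof -
  define q where "q x = x \<bullet> (A *v x)" for x
  have cont: "continuous_on UNIV q"
    unfolding q_def
    by (intro continuous_intros linear_continuous_on linear_conv_bounded_linear[THEN iffD1] linearI)
      (simp_all add: matrix_vector_right_distrib complex_matrix_vector_scaleR)
  have "compact (V \<inter> sphere 0 1)" using V(2) by (simp add: closed_Int_compact)
  moreover have "(1 / norm x0) *\<^sub>R x0 \<in> V \<inter> sphere 0 1"
    using assms by (simp add: subspace_scale)
  ultimately obtain v where v: "v \<in> V \<inter> sphere 0 1" "\<And>y. y \<in> V \<inter> sphere 0 1 \<Longrightarrow> q y \<le> q v"
    using continuous_attains_sup[of "V \<inter> sphere 0 1" q] continuous_on_subset[OF cont] by blast
  define l where "l = q v"
  define b where "b x y = l * (x \<bullet> y) - x \<bullet> (A *v y)" for x y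
  have b_nonneg: "0 \<le> b y y" if "y \<in> V" for y
  proof (cases "y = 0")
    case False
    then have "q ((1 / norm y) *\<^sub>R y) \<le> l"
      unfolding l_def using that V(1) by (intro v(2)) (simp add: subspace_scale)
    then have "q y / (norm y)\<^sup>2 \<le> l"
      by (simp add: q_def complex_matrix_vector_scaleR power2_eq_square)
    then show ?thesis
      using False by (simp add: b_def q_def field_simps power2_norm_eq_inner)
  qed (simp add: b_def)
  have b_v: "b v v = 0" using v(1) by (simp add: b_def l_def q_def dot_square_norm)
  define w where "w = l *\<^sub>R v - A *v v"
  have w: "w \<in> V" unfolding w_def using V v(1) by (simp add: subspace_diff subspace_scale)
  have b_w: "b w v = w \<bullet> w" by (simp add: b_def w_def inner_diff_right inner_diff_left)
  \<comment> \<open>The constant term \<open>b v v\<close> is zero, so a nonzero linear coefficient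
    \<open>w \<bullet> w\<close> would make the form negative for small positive
    \<open>t\<close>.\<close>
  have b_expand: "b (v - t *\<^sub>R w) (v - t *\<^sub>R w) = t\<^sup>2 * b w w - 2 * t * (w \<bullet> w)" for t
  proof -
    have sym: "b v w = b w v"
      using inner_matrix_vector_left[of A v w] A by (simp add: b_def inner_commute)
    have "b (v - t *\<^sub>R w) (v - t *\<^sub>R w) = b v v - t * b v w - t * b w v + t\<^sup>2 * b w w"
      by (simp add: b_def matrix_vector_mult_diff_distrib complex_matrix_vector_scaleR
          inner_diff_left inner_diff_right algebra_simps power2_eq_square)
    then show ?thesis using b_v b_w sym by simp
  qed
  have "w \<bullet> w \<le> 0"
  proof (rule ccontr)
    assume "\<not> w \<bullet> w \<le> 0"
    then have pos: "0 < w \<bullet> w" by linarith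
    \<comment> \<open>Half of the critical value \<open>2 * (w \<bullet> w) / b w w\<close>, up to
      the summand 1 that keeps the denominator positive.\<close>
    define t where "t = (w \<bullet> w) / (b w w + 1)"
    have "0 \<le> b w w" using b_nonneg w by blast
    then have t: "0 < t" "t * (b w w + 1) = w \<bullet> w" using pos by (auto simp: t_def)
    have "0 \<le> b (v - t *\<^sub>R w) (v - t *\<^sub>R w)"
      using v(1) w V(1) by (intro b_nonneg) (simp add: subspace_diff subspace_scale)
    then have "0 \<le> t * (t * b w w - 2 * (w \<bullet> w))"
      unfolding b_expand by (simp add: algebra_simps power2_eq_square)
    then have "2 * (w \<bullet> w) \<le> t * b w w" using t(1) by (simp add: zero_le_mult_iff)
    then show False using t pos by (simp add: algebra_simps)
  qed
  then have "w = 0" using inner_ge_zero[of w] inner_eq_zero_iff[of w] by linarith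
  then have "A *v v = l *\<^sub>R v" by (simp add: w_def)
  with v(1) show ?thesis using that by auto
qed

text \<open>Induction over the set \<open>I\<close> of indices whose rows of \<open>C\<close> already are orthonormal left eigenvectors;
  the other rows vanish.\<close>

lemma hermitian_partial_diagonalization:
  fixes A :: "complex^'n^'n"
  assumes A: "ct A = A" and "finite (I :: 'n set)"
  shows "\<exists>C l. C ** A = diag_matrix l ** C \<and> C ** ct C = diag_matrix (\<lambda>i. of_bool (i \<in> I))"
  using \<open>finite I\<close>
proof (induction I)
  case empty
  show ?case by (rule exI[of _ 0]) (simp add: vec_eq_iff diag_nth)
next
  case (insert i I)
  then obtain C l where C: "C ** A = diag_matrix l ** C" "C ** ct C = diag_matrix (\<lambda>i. of_bool (i \<in> I))"
    by blast
  have "of_real ((norm (C $ i))\<^sup>2) = (0 :: complex)"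
    using mult_ct_diag[of C i] insert.hyps C(2) by (simp add: diag_nth)
  then have Ci: "C $ i = 0" by simp
  \<comment> \<open>The zero row \<open>i\<close> keeps \<open>C\<close> from being invertible, so
    its kernel \<open>V\<close> is nontrivial; \<open>C ** A = diag_matrix l ** C\<close> makes
    \<open>V\<close> invariant under \<open>A\<close>.\<close>
  have "\<nexists>B. C ** B = mat 1"
  proof
    assume "\<exists>B. C ** B = mat 1"
    then obtain B where "C ** B = mat 1" by blast
    then have "(C ** B) $ i $ i = (mat 1 :: complex^'n^'n) $ i $ i" by simp
    then show False by (simp add: matrix_matrix_mult_def Ci mat_def)
  qed
  then have "\<nexists>B. B ** C = mat 1" using matrix_left_right_inverse by blast
  then obtain x0 where x0: "C *v x0 = 0" "x0 \<noteq> 0" unfolding matrix_left_invertible_ker by blast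
  define V where "V = {x. C *v x = 0}"
  have lin: "linear ((*v) C)"
    by (rule linearI) (simp_all add: matrix_vector_right_distrib complex_matrix_vector_scaleR)
  have "subspace V" unfolding V_def by (rule linear_subspace_kernel[OF lin])
  moreover have "closed V"
    unfolding V_def
    by (intro closed_Collect_eq linear_continuous_on linear_conv_bounded_linear[THEN iffD1] lin continuous_intros)
  moreover have "A *v x \<in> V" if "x \<in> V" for x
  proof -
    have "C *v (A *v x) = diag_matrix l *v (C *v x)"
      by (simp add: matrix_vector_mul_assoc C(1))
    then show ?thesis using that by (simp add: V_def)
  qed
  ultimately obtain v m where v: "v \<in> V" "norm v = 1" "A *v v = m *\<^sub>R v"
    using hermitian_eigenvector_in_invariant_subspace[OF A, of V x0] x0 by (auto simp: V_def)
  \<comment> \<open>The eigenvector enters as a conjugated row because the rows of \<open>C\<close>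
    are left eigenvectors; \<open>C *v v = 0\<close> makes it orthogonal to the others.\<close>
  define C' where "C' = (\<chi> j. if j = i then (\<chi> k. cnj (v $ k)) else C $ j)"
  define l' where "l' = l(i := m)"
  have "C' ** A = diag_matrix l' ** C'"
  proof -
    have "(C' ** A) $ j $ k = (diag_matrix l' ** C') $ j $ k" for j k
    proof (cases "j = i")
      case True
      have "(\<Sum>a\<in>UNIV. cnj (v $ a) * A $ a $ k) = cnj ((A *v v) $ k)"
      proof -
        have "A $ a $ k = cnj (A $ k $ a)" for a using A ct_nth[of A a k] by simp
        then show ?thesis by (simp add: matrix_vector_mult_def mult.commute)
      qed
      also have "\<dots> = of_real m * cnj (v $ k)"
        unfolding v(3) by (simp add: scaleR_conv_of_real[of m "v $ k"])
      finally have "(\<Sum>a\<in>UNIV. cnj (v $ a) * A $ a $ k) = of_real m * cnj (v $ k)" .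
      moreover have "(C' ** A) $ j $ k = (\<Sum>a\<in>UNIV. cnj (v $ a) * A $ a $ k)"
        using True by (simp add: matrix_matrix_mult_def C'_def)
      ultimately show ?thesis using True by (simp add: diag_mult_nth) (simp add: C'_def l'_def)
    next
      case False
      have "(C' ** A) $ j $ k = (C ** A) $ j $ k"
        using False by (simp add: matrix_matrix_mult_def C'_def)
      then show ?thesis using False by (simp add: C(1) diag_mult_nth C'_def l'_def)
    qed
    then show ?thesis by (simp add: vec_eq_iff)
  qed
  moreover have "C' ** ct C' = diag_matrix (\<lambda>j. of_bool (j \<in> insert i I))"
  proof -
    have Cv: "(\<Sum>a\<in>UNIV. C $ j $ a * v $ a) = 0" for j
    proof -
      have "(C *v v) $ j = 0" using v(1) by (simp add: V_def)
      then show ?thesis by (simp add: matrix_vector_mult_def)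
    qed
    have Cv': "(\<Sum>a\<in>UNIV. cnj (v $ a) * cnj (C $ j $ a)) = 0" for j
    proof -
      have "(\<Sum>a\<in>UNIV. cnj (v $ a) * cnj (C $ j $ a)) = cnj (\<Sum>a\<in>UNIV. C $ j $ a * v $ a)"
        by (simp add: mult.commute)
      then show ?thesis unfolding Cv by simp
    qed
    have vv: "(\<Sum>a\<in>UNIV. cnj (v $ a) * v $ a) = 1"
    proof -
      have "(\<Sum>a\<in>UNIV. cnj (v $ a) * v $ a) = of_real ((norm v)\<^sup>2)"
        by (simp add: norm_sq_row complex_norm_square mult.commute del: of_real_power)
      then show ?thesis using v(2) by simp
    qed
    have CC: "(\<Sum>a\<in>UNIV. C $ j $ a * cnj (C $ k $ a)) = (if j = k then of_bool (j \<in> I) else 0)" for j k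
    proof -
      have "(C ** ct C) $ j $ k = diag_matrix (\<lambda>i. of_bool (i \<in> I)) $ j $ k" by (simp add: C(2))
      then show ?thesis by (simp add: matrix_matrix_mult_def diag_nth)
    qed
    have "(C' ** ct C') $ j $ k = diag_matrix (\<lambda>j. of_bool (j \<in> insert i I)) $ j $ k" for j k
      using insert.hyps by (auto simp: matrix_matrix_mult_def diag_nth C'_def Cv Cv' vv CC)
    then show ?thesis by (simp add: vec_eq_iff)
  qed
  ultimately show ?case by blast
qed

theorem hermitian_diagonalization:
  fixes A :: "complex^'n^'n"
  assumes "ct A = A"
  obtains U d where "unitary U" "A = U ** diag_matrix d ** ct U"
proof -
  obtain C l where C: "C ** A = diag_matrix l ** C" "C ** ct C = diag_matrix (\<lambda>i. of_bool (i \<in> (UNIV :: 'n set)))"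
    using hermitian_partial_diagonalization[OF assms, of UNIV] by auto
  have 1: "C ** ct C = mat 1" using C(2) by (simp add: diag_1)
  then have 2: "ct C ** C = mat 1" using matrix_left_right_inverse by blast
  have "unitary (ct C)" using 1 2 by (simp add: unitary_def)
  moreover have "A = ct C ** diag_matrix l ** ct (ct C)"
  proof -
    have "ct C ** diag_matrix l ** C = ct C ** C ** A" by (simp only: matrix_mul_assoc[symmetric] C(1))
    then show ?thesis by (simp add: 2)
  qed
  ultimately show ?thesis using that by blast
qed

lemma pos_semidef_mult_ct: "pos_semidef (X ** ct X)" for X :: "complex^'p^'n"
proof -
  have "v \<bullet> ((X ** ct X) *v v) = (ct X *v v) \<bullet> (ct X *v v)" for v
    by (simp add: inner_matrix_vector_left[of "ct X"] matrix_vector_mul_assoc)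
  then show ?thesis by (simp add: pos_semidef_def ct_mult)
qed

lemma pos_semidef_diagonalization:
  assumes "pos_semidef A"
  obtains U d where "unitary U" "\<And>i. 0 \<le> d i" "A = U ** diag_matrix d ** ct U"
proof -
  obtain U d where U: "unitary U" "A = U ** diag_matrix d ** ct U"
    using hermitian_diagonalization assms unfolding pos_semidef_def by metis
  have "0 \<le> d i" for i
  proof -
    \<comment> \<open>\<open>U *v e\<close> is column \<open>i\<close> of \<open>U\<close>, an
      eigenvector of \<open>A\<close> for \<open>d i\<close>; positivity is tested there.\<close>
    define e :: "complex^'a" where "e = axis i 1"
    have "0 \<le> (U *v e) \<bullet> (A *v (U *v e))" using assms by (simp add: pos_semidef_def)
    also have "A *v (U *v e) = U *v (d i *\<^sub>R e)"
    proof -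
      have "A *v (U *v e) = (U ** diag_matrix d ** ct U ** U) *v e"
        by (simp add: U(2) matrix_vector_mul_assoc)
      also have "\<dots> = U *v (diag_matrix d *v e)"
        using U(1) by (simp add: unitary_cancel matrix_vector_mul_assoc)
      also have "diag_matrix d *v e = d i *\<^sub>R e"
        by (auto simp: vec_eq_iff matrix_vector_mult_def diag_nth e_def axis_def
            scaleR_conv_of_real[of "d i" "1 :: complex"] if_distrib[of "\<lambda>x. _ * x"] cong: if_cong)
      finally show ?thesis .
    qed
    also have "(U *v e) \<bullet> (U *v (d i *\<^sub>R e)) = d i * (norm (U *v e))\<^sup>2"
      by (simp add: complex_matrix_vector_scaleR power2_norm_eq_inner)
    also have "(norm (U *v e))\<^sup>2 = 1"
      using unitary_col_sum[OF U(1), of i]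
      by (simp add: norm_sq_row matrix_vector_mult_def e_def axis_def if_distrib[of "\<lambda>x. _ * x"] cong: if_cong)
    finally show ?thesis by simp
  qed
  with U that show ?thesis by blast
qed

lemma left_singular_decomp_exists:
  fixes X :: "complex^'p^'n"
  obtains U d where "left_singular_decomp X U d"
proof -
  obtain U d where U: "unitary U" "\<And>i. 0 \<le> d i" "X ** ct X = U ** diag_matrix d ** ct U"
    using pos_semidef_diagonalization[OF pos_semidef_mult_ct] by blast
  then have "left_singular_decomp X U (\<lambda>i. sqrt (d i))"
    by (simp add: left_singular_decomp_def diag_mult_diag)
  then show ?thesis using that by blast
qed

section \<open>Singular values and functions of positive semidefinite matrices\<close>

text \<open>\<open>ct U' ** U\<close> intertwines the two diagonal matrices, so its nonzero entries
  sit only where the eigenvalues agree. Together with the converse \<open>unitary_diag_eqI\<close>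
  this makes functions of a Hermitian matrix independent of the chosen diagonalization, without
  speaking of eigenspaces.\<close>

lemma unitary_diag_apply_eq:
  fixes U U' :: "complex^'n^'n" and f f' :: "'n \<Rightarrow> real"
  assumes U: "unitary U" "unitary U'"
    and eq: "U ** diag_matrix f ** ct U = U' ** diag_matrix f' ** ct U'"
    and "(ct U' ** U) $ i $ j \<noteq> 0"
  shows "f j = f' i"
proof -
  have "ct U' ** (U ** diag_matrix f ** ct U) ** U = ct U' ** (U' ** diag_matrix f' ** ct U') ** U"
    by (simp only: eq)
  then have "(ct U' ** U) ** diag_matrix f = diag_matrix f' ** (ct U' ** U)"
    using U by (simp add: matrix_mul_assoc unitary_cancel) (simp add: unitary_def)
  then have "(ct U' ** U) $ i $ j * of_real (f j) = of_real (f' i) * (ct U' ** U) $ i $ j"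
    by (metis diag_mult_nth mult_diag_nth)
  then show ?thesis using assms(4) by simp
qed

lemma unitary_diag_eqI:
  fixes U U' :: "complex^'n^'n" and g g' :: "'n \<Rightarrow> real"
  assumes U: "unitary U" "unitary U'"
    and "\<And>i j. (ct U' ** U) $ i $ j \<noteq> 0 \<Longrightarrow> g j = g' i"
  shows "U ** diag_matrix g ** ct U = U' ** diag_matrix g' ** ct U'"
proof -
  define V where "V = ct U' ** U"
  have "V ** diag_matrix g = diag_matrix g' ** V"
    using assms(3) by (force simp: vec_eq_iff diag_mult_nth mult_diag_nth V_def)
  then have "U' ** (V ** diag_matrix g) ** ct U = U' ** (diag_matrix g' ** V) ** ct U"
    by simp
  moreover have "U' ** (V ** diag_matrix g) ** ct U = U ** diag_matrix g ** ct U"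
    using U by (simp add: V_def matrix_mul_assoc) (simp add: unitary_def)
  moreover have "U' ** (diag_matrix g' ** V) ** ct U = U' ** diag_matrix g' ** ct U'"
    using U by (simp add: V_def matrix_mul_assoc unitary_cancel)
  ultimately show ?thesis by simp
qed

lemma left_singular_decomp_same:
  assumes "left_singular_decomp X U d" "left_singular_decomp X U' d'" "(ct U' ** U) $ i $ j \<noteq> 0"
  shows "d j = d' i"
proof -
  have "(d j)\<^sup>2 = (d' i)\<^sup>2"
    using left_singular_decompD(3)[OF assms(1)] left_singular_decompD(3)[OF assms(2)]
    by (intro unitary_diag_apply_eq[of U U' "\<lambda>i. (d i)\<^sup>2" "\<lambda>i. (d' i)\<^sup>2", OF _ _ _ assms(3)]
        left_singular_decompD(1)[OF assms(1)] left_singular_decompD(1)[OF assms(2)]) simp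
  then show ?thesis
    using left_singular_decompD(2)[OF assms(1), of j] left_singular_decompD(2)[OF assms(2), of i] by simp
qed

text \<open>Rows and columns of the unitary matrix \<open>U'\<^sup>* U\<close> have norm 1, and its entries vanish off the
  blocks of equal singular values.\<close>

lemma left_singular_decomp_unique:
  assumes 1: "left_singular_decomp X U d" and 2: "left_singular_decomp X U' d'"
  shows "image_mset d (mset_set UNIV) = image_mset d' (mset_set UNIV)"
proof (rule multiset_eqI)
  fix t
  define V where "V = ct U' ** U"
  have V: "unitary V"
    unfolding V_def using left_singular_decompD(1) 1 2 by (intro unitary_mult unitary_ct) auto
  have zero: "V $ i $ j = 0" if "d j \<noteq> d' i" for i j
    using left_singular_decomp_same[OF 1 2, of i j] that by (auto simp: V_def)
  have "real (card {j. d j = t}) = (\<Sum>j | d j = t. \<Sum>i\<in>UNIV. (norm (V $ i $ j))\<^sup>2)"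
    by (simp add: unitary_col_sum[OF V])
  also have "\<dots> = (\<Sum>j | d j = t. \<Sum>i | d' i = t. (norm (V $ i $ j))\<^sup>2)"
    using zero by (intro sum.cong sum.mono_neutral_right) auto
  also have "\<dots> = (\<Sum>i | d' i = t. \<Sum>j | d j = t. (norm (V $ i $ j))\<^sup>2)"
    by (rule sum.swap)
  also have "\<dots> = (\<Sum>i | d' i = t. \<Sum>j\<in>UNIV. (norm (V $ i $ j))\<^sup>2)"
    using zero by (intro sum.cong sum.mono_neutral_left) auto
  also have "\<dots> = real (card {i. d' i = t})"
    by (simp add: unitary_row_sum[OF V])
  finally have "card {j. d j = t} = card {i. d' i = t}" by simp
  moreover have "count (image_mset f (mset_set UNIV)) t = card {j. f j = t}" for f :: "'b \<Rightarrow> real"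
    by (simp add: count_image_mset vimage_def)
  ultimately show "count (image_mset d (mset_set UNIV)) t = count (image_mset d' (mset_set UNIV)) t"
    by simp
qed

lemma singular_values_eq:
  assumes "left_singular_decomp X U d"
  shows "singular_values X = image_mset d (mset_set UNIV)"
  unfolding singular_values_def
  using assms left_singular_decomp_unique[OF _ assms] by (intro the_equality) blast+

text \<open>Replaces the sorted list behind \<open>singular_value\<close> by a set of indices. The
  index \<open>i\<close> is kept apart from \<open>B\<close> so that \<open>insert i B\<close>
  supplies \<open>K + 1\<close> singular values that are at least \<open>d i\<close>.\<close>

lemma singular_value_split:
  fixes X :: "complex^'p^'n"
  assumes X: "left_singular_decomp X U d" and K: "K < CARD('n)"
  obtains B i where "card B = K" "i \<notin> B" "singular_value (K + 1) X = d i"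
    "\<And>j. j \<in> B \<Longrightarrow> d i \<le> d j" "\<And>j. j \<notin> B \<Longrightarrow> d j \<le> d i"
proof -
  obtain ys :: "'n list" where ys: "distinct ys" "set ys = UNIV"
    using finite_distinct_list[of "UNIV :: 'n set"] by auto
  define xs where "xs = rev (sort_key d ys)"
  have xs: "distinct xs" "set xs = UNIV" using ys by (auto simp: xs_def)
  then have len: "length xs = CARD('n)" using distinct_card by force
  have srt: "sorted (map d (rev xs))" by (simp add: xs_def)
  have "mset (map d (rev xs)) = singular_values X"
    using xs mset_set_set[OF xs(1)] by (simp add: singular_values_eq[OF X])
  then have "sorted_list_of_multiset (singular_values X) = map d (rev xs)"
    using srt by (metis sorted_list_of_multiset_mset sorted_sort_id)
  \<comment> \<open>\<open>singular_value\<close> counts from 1, list positions from 0.\<close>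
  then have sv: "singular_value (K + 1) X = d (xs ! K)"
    using K len by (simp add: singular_value_def rev_map)
  have mono: "d (xs ! b) \<le> d (xs ! a)" if "a \<le> b" "b < CARD('n)" for a b
  proof -
    have "sorted_wrt (\<ge>) (map d xs)" using srt by (simp add: rev_map[symmetric] sorted_wrt_rev)
    then show ?thesis using that len by (cases "a = b") (auto simp: sorted_wrt_iff_nth_less)
  qed
  define B where "B = set (take K xs)"
  show ?thesis
  proof (rule that[of B "xs ! K"])
    show "card B = K" using K len xs(1) by (simp add: B_def distinct_card)
    show "xs ! K \<notin> B" using K len xs(1) by (auto simp: B_def in_set_conv_nth nth_eq_iff_index_eq)
    show "singular_value (K + 1) X = d (xs ! K)" by (rule sv)
    show "d (xs ! K) \<le> d j" if "j \<in> B" for j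
      using that K len mono by (auto simp: B_def in_set_conv_nth)
    show "d j \<le> d (xs ! K)" if "j \<notin> B" for j
    proof -
      obtain a where a: "a < CARD('n)" "j = xs ! a" using xs(2) len by (metis UNIV_I in_set_conv_nth)
      have "K \<le> a"
      proof (rule ccontr)
        assume "\<not> K \<le> a"
        then have "take K xs ! a = j" "a < length (take K xs)" using a K len by auto
        then show False using that nth_mem by (metis B_def)
      qed
      then show ?thesis using mono a by simp
    qed
  qed
qed

section \<open>Weights and square roots as functions of a matrix\<close>

lemma irls_weight_eq:
  assumes "left_singular_decomp X U d"
  shows "irls_weight X \<epsilon> = U ** diag_matrix (\<lambda>i. inverse (max (d i) \<epsilon>)) ** ct U"
  unfolding irls_weight_def
proof (rule the_equality)
  show "\<exists>U' d'. left_singular_decomp X U' d' \<and> U ** diag_matrix (\<lambda>i. inverse (max (d i) \<epsilon>)) ** ct U =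
      U' ** diag_matrix (\<lambda>i. inverse (max (d' i) \<epsilon>)) ** ct U'"
    using assms by blast
next
  fix W assume "\<exists>U' d'. left_singular_decomp X U' d' \<and> W = U' ** diag_matrix (\<lambda>i. inverse (max (d' i) \<epsilon>)) ** ct U'"
  then obtain U' d' where *: "left_singular_decomp X U' d'"
    "W = U' ** diag_matrix (\<lambda>i. inverse (max (d' i) \<epsilon>)) ** ct U'" by blast
  show "W = U ** diag_matrix (\<lambda>i. inverse (max (d i) \<epsilon>)) ** ct U"
    unfolding *(2)
    by (rule unitary_diag_eqI)
      (use left_singular_decompD(1) assms * left_singular_decomp_same[OF *(1) assms] in auto)
qed

lemma pos_semidef_unitary_diag:
  assumes "unitary U" "\<And>i. 0 \<le> d i" shows "pos_semidef (U ** diag_matrix d ** ct U)"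
proof -
  have "diag_matrix (\<lambda>i. sqrt (d i)) ** diag_matrix (\<lambda>i. sqrt (d i)) = diag_matrix d"
    using assms(2) by (simp add: diag_mult_diag)
  then have "U ** diag_matrix d ** ct U =
      (U ** diag_matrix (\<lambda>i. sqrt (d i))) ** ct (U ** diag_matrix (\<lambda>i. sqrt (d i)))"
    by (simp add: ct_mult matrix_mul_assoc) (simp add: matrix_mul_assoc[symmetric])
  then show ?thesis using pos_semidef_mult_ct by simp
qed

lemma unitary_diag_mult:
  "unitary U \<Longrightarrow> (U ** diag_matrix a ** ct U) ** (U ** diag_matrix b ** ct U) =
    U ** diag_matrix (\<lambda>i. a i * b i) ** ct U"
  by (simp add: matrix_mul_assoc unitary_cancel diag_mult_diag[symmetric])

text \<open>Any other positive semidefinite root is diagonalized too: its squared eigenvalues match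
  \<open>w\<close>, and nonnegative numbers have unique square roots.\<close>

lemma matrix_sqrt_eq:
  assumes U: "unitary U" and w: "\<And>i. 0 \<le> w i"
  shows "matrix_sqrt (U ** diag_matrix w ** ct U) = U ** diag_matrix (\<lambda>i. sqrt (w i)) ** ct U"
  unfolding matrix_sqrt_def
proof (rule the_equality)
  show "pos_semidef (U ** diag_matrix (\<lambda>i. sqrt (w i)) ** ct U) \<and>
      U ** diag_matrix (\<lambda>i. sqrt (w i)) ** ct U ** (U ** diag_matrix (\<lambda>i. sqrt (w i)) ** ct U) =
      U ** diag_matrix w ** ct U"
    using U w pos_semidef_unitary_diag[OF U, of "\<lambda>i. sqrt (w i)"] by (simp add: unitary_diag_mult)
next
  fix B assume B: "pos_semidef B \<and> B ** B = U ** diag_matrix w ** ct U"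
  then obtain V b where V: "unitary V" "\<And>i. 0 \<le> b i" "B = V ** diag_matrix b ** ct V"
    using pos_semidef_diagonalization by blast
  have BB: "V ** diag_matrix (\<lambda>i. b i * b i) ** ct V = U ** diag_matrix w ** ct U"
    using B V by (simp add: unitary_diag_mult)
  have "b j = sqrt (w i)" if "(ct U ** V) $ i $ j \<noteq> 0" for i j
    using unitary_diag_apply_eq[OF V(1) U BB that] V(2)[of j] by (metis real_sqrt_mult_self abs_of_nonneg real_sqrt_abs2)
  then show "B = U ** diag_matrix (\<lambda>i. sqrt (w i)) ** ct U"
    unfolding V(3) by (rule unitary_diag_eqI[OF V(1) U])
qed

section \<open>Rank and nuclear norm\<close>

lemma row_mult_in_span: "(A ** B) $ i \<in> vec.span (rows B)" for B :: "'a::field^'p^'n"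
proof -
  have "(A ** B) $ i = (\<Sum>k\<in>UNIV. A $ i $ k *s B $ k)"
    by (simp add: vec_eq_iff matrix_matrix_mult_def)
  also have "\<dots> \<in> vec.span (rows B)"
    by (intro vec.span_sum vec.span_scale vec.span_base) (auto simp: rows_def row_def vec_lambda_eta)
  finally show ?thesis .
qed

lemma rows_eq: "rows A = range (($) A)"
  by (auto simp: rows_def row_def vec_lambda_eta)

lemma rank_mult_le_right: "rank (A ** B) \<le> rank B" for B :: "'a::field^'p^'n"
  unfolding row_rank_def_gen
  by (rule vec.dim_mono) (use row_mult_in_span[of A B] in \<open>auto simp: rows_eq\<close>)

lemma rank_add_le: "rank (A + B) \<le> rank A + rank B" for A B :: "'a::field^'p^'n"
proof -
  obtain S where S: "vec.independent S" "rows A \<subseteq> vec.span S" "card S = vec.dim (rows A)"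
    by (metis vec.basis_exists)
  obtain T where T: "vec.independent T" "rows B \<subseteq> vec.span T" "card T = vec.dim (rows B)"
    by (metis vec.basis_exists)
  have "rows (A + B) \<subseteq> vec.span (S \<union> T)"
  proof
    fix r assume "r \<in> rows (A + B)"
    then obtain i where "r = A $ i + B $ i" by (auto simp: rows_eq)
    moreover have "A $ i \<in> vec.span (S \<union> T)"
      using S(2) vec.span_mono[of S "S \<union> T"] by (auto simp: rows_eq)
    moreover have "B $ i \<in> vec.span (S \<union> T)"
      using T(2) vec.span_mono[of T "S \<union> T"] by (auto simp: rows_eq)
    ultimately show "r \<in> vec.span (S \<union> T)" by (simp add: vec.span_add)
  qed
  moreover have "finite (S \<union> T)"
    using S(1) T(1) vec.finiteI_independent by blast
  ultimately have "rank (A + B) \<le> card (S \<union> T)"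
    unfolding row_rank_def_gen by (rule vec.dim_le_card)
  also have "\<dots> \<le> rank A + rank B"
    unfolding row_rank_def_gen using S(3) T(3) card_Un_le[of S T] by simp
  finally show ?thesis .
qed

lemma rank_scaleR_le: "rank (c *\<^sub>R A) \<le> rank A" for A :: "complex^'p^'n"
proof -
  have "c *\<^sub>R A = diag_matrix (\<lambda>_. c) ** A" by (simp add: vec_eq_iff[of _ "_ ** _"] diag_mult_row)
  then show ?thesis using rank_mult_le_right by metis
qed

lemma rank_diff_le: "rank (A - B) \<le> rank A + rank B" for A B :: "complex^'p^'n"
proof -
  have eq: "A - B = A + (-1) *\<^sub>R B" by simp
  have "rank (A - B) \<le> rank A + rank ((-1) *\<^sub>R B)" unfolding eq by (rule rank_add_le)
  then show ?thesis using rank_scaleR_le[of "-1" B] by (rule order_trans[OF _ add_left_mono])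
qed

lemma rank_diag_mult_le: "rank (U ** diag_matrix (\<lambda>i. of_bool (i \<in> I)) ** Y) \<le> card I"
  for U :: "complex^'n^'m" and Y :: "complex^'p^'n"
proof -
  let ?Z = "diag_matrix (\<lambda>i. of_bool (i \<in> I)) ** Y"
  have "rank (U ** ?Z) \<le> rank ?Z" by (rule rank_mult_le_right)
  also have "\<dots> \<le> card ((\<lambda>i. Y $ i) ` I)"
    unfolding row_rank_def_gen
    by (rule vec.dim_le_card) (auto simp: rows_eq diag_mult_row intro: vec.span_base[OF imageI] vec.span_zero)
  also have "\<dots> \<le> card I" by (rule card_image_le) simp
  finally show ?thesis by (simp add: matrix_mul_assoc)
qed

text \<open>The rows of \<open>ct U ** X\<close> are mutually orthogonal with norms
  \<open>d i\<close>, so the nonzero ones are linearly independent over the complex numbers.\<close>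

lemma card_singular_values_le_rank:
  fixes X :: "complex^'p^'n"
  assumes X: "left_singular_decomp X U d"
  shows "card {i. d i \<noteq> 0} \<le> rank X"
proof -
  define Y where "Y = ct U ** X"
  have "Y ** ct Y = ct U ** (X ** ct X) ** U"
    by (simp add: Y_def ct_mult matrix_mul_assoc)
  also have "\<dots> = diag_matrix (\<lambda>i. (d i)\<^sup>2)"
    using left_singular_decompD(1,3)[OF X] by (simp add: matrix_mul_assoc unitary_cancel) (simp add: unitary_def)
  finally have "(Y ** ct Y) $ j $ i = (if j = i then of_real ((d j)\<^sup>2) else 0)" for i j
    by (simp add: diag_nth)
  \<comment> \<open>The Hermitian products of the rows are spelled out because
    \<open>\<bullet>\<close> gives only their real parts.\<close>
  then have gram: "(\<Sum>k\<in>UNIV. Y $ j $ k * cnj (Y $ i $ k)) = (if j = i then of_real ((d j)\<^sup>2) else 0)" for i j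
    by (simp add: matrix_matrix_mult_def)
  define I where "I = {i. d i \<noteq> 0}"
  have inj: "inj_on (($) Y) I"
  proof (rule inj_onI)
    fix i j assume "i \<in> I" "j \<in> I" "Y $ i = Y $ j"
    then show "i = j" using gram[of i i] gram[of j i] by (auto simp: I_def split: if_splits)
  qed
  have "vec.independent (($) Y ` I)"
  proof (rule vec.independent_if_scalars_zero)
    show "finite (($) Y ` I)" by simp
    fix f x assume sum0: "(\<Sum>x\<in>($) Y ` I. f x *s x) = 0" and "x \<in> ($) Y ` I"
    then obtain i where i: "i \<in> I" "x = Y $ i" by blast
    have "(\<Sum>j\<in>I. f (Y $ j) *s Y $ j) = 0" using sum0 by (simp add: sum.reindex[OF inj])
    then have "(\<Sum>j\<in>I. f (Y $ j) *s Y $ j) $ k = 0" for k by simp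
    then have "(\<Sum>j\<in>I. f (Y $ j) * Y $ j $ k) = 0" for k by simp
    then have "0 = (\<Sum>k\<in>UNIV. (\<Sum>j\<in>I. f (Y $ j) * Y $ j $ k) * cnj (Y $ i $ k))" by simp
    also have "\<dots> = (\<Sum>k\<in>UNIV. \<Sum>j\<in>I. f (Y $ j) * (Y $ j $ k * cnj (Y $ i $ k)))"
      by (simp only: sum_distrib_right mult.assoc)
    also have "\<dots> = (\<Sum>j\<in>I. \<Sum>k\<in>UNIV. f (Y $ j) * (Y $ j $ k * cnj (Y $ i $ k)))" by (rule sum.swap)
    also have "\<dots> = (\<Sum>j\<in>I. f (Y $ j) * (if j = i then of_real ((d j)\<^sup>2) else 0))"
      by (simp only: sum_distrib_left[symmetric] gram)
    also have "\<dots> = f (Y $ i) * of_real ((d i)\<^sup>2)"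
      using i by (simp add: if_distrib[of "\<lambda>x. _ * x"] cong: if_cong)
    finally show "f x = 0" using i by (simp add: I_def)
  qed
  then have "card (($) Y ` I) \<le> rank Y"
    unfolding row_rank_def_gen by (intro vec.independent_card_le_dim) (auto simp: rows_eq)
  also have "\<dots> \<le> rank X" unfolding Y_def by (rule rank_mult_le_right)
  finally show ?thesis by (simp add: card_image[OF inj]) (simp add: I_def)
qed

section \<open>The nuclear norm and its duality with contractions\<close>

definition nuclear_norm :: "complex^'p^'n \<Rightarrow> real" where
  "nuclear_norm X = sum_mset (singular_values X)"

lemma nuclear_norm_eq: "left_singular_decomp X U d \<Longrightarrow> nuclear_norm X = (\<Sum>i\<in>UNIV. d i)"
  by (simp add: nuclear_norm_def singular_values_eq sum_unfold_sum_mset)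

lemma nuclear_norm_ge_norm: "norm X \<le> nuclear_norm X"
proof -
  obtain U d where X: "left_singular_decomp X U d" by (rule left_singular_decomp_exists)
  have "norm X = L2_set d UNIV"
    using norm_sq_decomp[OF X] by (metis L2_set_def norm_ge_zero real_sqrt_unique)
  also have "\<dots> \<le> nuclear_norm X"
    unfolding nuclear_norm_eq[OF X] using left_singular_decompD(2)[OF X] by (intro L2_set_le_sum) auto
  finally show ?thesis .
qed

lemma nuclear_norm_nonneg: "0 \<le> nuclear_norm X"
  using nuclear_norm_ge_norm[of X] norm_ge_zero[of X] by linarith

lemma nuclear_norm_minus: "nuclear_norm (- X) = nuclear_norm X"
proof -
  obtain U d where X: "left_singular_decomp X U d" by (rule left_singular_decomp_exists)
  have "(- X) ** ct (- X) = X ** ct X" by (simp add: vec_eq_iff matrix_matrix_mult_def)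
  then have "left_singular_decomp (- X) U d" using X by (simp add: left_singular_decomp_def)
  then show ?thesis using X by (simp add: nuclear_norm_eq)
qed

text \<open>A row-wise way of saying that the operator norm of \<open>G\<close> is at most 1.\<close>

definition contraction :: "complex^'p^'n \<Rightarrow> bool" where
  "contraction G \<longleftrightarrow> (\<forall>U i. unitary U \<longrightarrow> norm ((U ** G) $ i) \<le> 1)"

text \<open>By \<open>row_norm_mult\<close>, the squared norm of a row of \<open>V ** G\<close> is
  an average of the squared singular values, weighted by the squared moduli in a row of the unitary
  matrix \<open>V ** U\<close>.\<close>

lemma contraction_if_singular_values_le_1:
  assumes G: "left_singular_decomp G U g" and "\<And>i. g i \<le> 1"
  shows "contraction G"
  unfolding contraction_def
proof (intro allI impI)
  fix V i assume "unitary (V :: complex^'b^'b)"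
  then have V: "unitary (V ** U)" using left_singular_decompD(1)[OF G] by (rule unitary_mult)
  have "(norm ((V ** G) $ i))\<^sup>2 \<le> (\<Sum>j\<in>UNIV. (norm ((V ** U) $ i $ j))\<^sup>2)"
    unfolding row_norm_mult[OF G] using assms(2) left_singular_decompD(2)[OF G]
    by (intro sum_mono mult_left_le) (auto simp: power_le_one)
  then have "(norm ((V ** G) $ i))\<^sup>2 \<le> 1" using unitary_row_sum[OF V] by simp
  then show "norm ((V ** G) $ i) \<le> 1" by (simp add: power_le_one_iff)
qed

text \<open>\<open>G ** ct G\<close> is idempotent, so every singular value of \<open>G\<close> is 0
  or 1.\<close>

lemma contraction_if_partial_isometry:
  assumes "G ** ct G ** G = G" shows "contraction G"
proof -
  obtain U g where G: "left_singular_decomp G U g" by (rule left_singular_decomp_exists)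
  note D = left_singular_decompD[OF G]
  have "(G ** ct G) ** (G ** ct G) = G ** ct G" using assms by (simp add: matrix_mul_assoc)
  then have eq: "U ** diag_matrix (\<lambda>i. (g i)\<^sup>2 * (g i)\<^sup>2) ** ct U = U ** diag_matrix (\<lambda>i. (g i)\<^sup>2) ** ct U"
    unfolding D(3) unitary_diag_mult[OF D(1)] .
  have "(g i)\<^sup>2 * (g i)\<^sup>2 = (g i)\<^sup>2" for i
    by (rule unitary_diag_apply_eq[OF D(1) D(1) eq]) (use D(1) in \<open>simp add: unitary_def mat_def\<close>)
  then have "g i = 0 \<or> (g i)\<^sup>2 = 1" for i by (metis mult_cancel_right1 power2_eq_square mult_eq_0_iff)
  then have "g i \<le> 1" for i using D(2)[of i] by (metis order_refl power2_eq_1_iff zero_le_one le_minus_one_simps(1) order_trans)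
  then show ?thesis by (rule contraction_if_singular_values_le_1[OF G])
qed

lemma inner_unitary: "unitary U \<Longrightarrow> (U ** X) \<bullet> (U ** Y) = X \<bullet> Y"
  by (simp add: inner_mult_left unitary_cancel)

text \<open>The duality of operator norm and nuclear norm, by Cauchy-Schwarz in each row after
  passing to the left singular vectors of \<open>X\<close>.\<close>

lemma contraction_inner_le:
  assumes "contraction G" shows "G \<bullet> X \<le> nuclear_norm X"
proof -
  obtain U d where X: "left_singular_decomp X U d" by (rule left_singular_decomp_exists)
  have U: "unitary (ct U)" using X by (simp add: left_singular_decompD unitary_ct)
  have "G \<bullet> X = (\<Sum>i\<in>UNIV. (ct U ** G) $ i \<bullet> (ct U ** X) $ i)"
    using inner_unitary[OF U, of G X] by (simp add: inner_vec_def)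
  also have "\<dots> \<le> (\<Sum>i\<in>UNIV. 1 * d i)"
  proof (rule sum_mono)
    fix i
    have "(ct U ** G) $ i \<bullet> (ct U ** X) $ i \<le> norm ((ct U ** G) $ i) * norm ((ct U ** X) $ i)"
      by (rule norm_cauchy_schwarz)
    also have "\<dots> \<le> 1 * d i"
      unfolding row_norm_decomp[OF X] using assms U left_singular_decompD(2)[OF X]
      by (intro mult_right_mono) (auto simp: contraction_def)
    finally show "(ct U ** G) $ i \<bullet> (ct U ** X) $ i \<le> 1 * d i" .
  qed
  finally show ?thesis by (simp add: nuclear_norm_eq[OF X])
qed

lemma inner_unitary_diag:
  assumes "unitary U"
  shows "X \<bullet> ((U ** diag_matrix w ** ct U) ** Y) = (\<Sum>i\<in>UNIV. w i * ((ct U ** X) $ i \<bullet> (ct U ** Y) $ i))"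
proof -
  have "X \<bullet> ((U ** diag_matrix w ** ct U) ** Y) = (ct U ** X) \<bullet> (diag_matrix w ** (ct U ** Y))"
    by (simp add: inner_mult_left matrix_mul_assoc)
  then show ?thesis by (simp add: inner_vec_def[of "ct U ** X"] diag_mult_row)
qed

text \<open>\<open>G\<close> is the partial isometry of the polar decomposition, with the same
  column and row spaces as \<open>X\<close>. It attains equality in
  \<open>contraction_inner_le\<close>, and \<open>G ** ct G\<close> and \<open>ct G ** G\<close>
  serve as the orthogonal projections onto these two spaces.\<close>

lemma polar_factor:
  fixes X :: "complex^'p^'n"
  obtains G where "G ** ct G ** G = G" "G ** ct G ** X = X" "X ** ct G ** G = X"
    "X \<bullet> G = nuclear_norm X" "(norm G)\<^sup>2 \<le> real (rank X)"
    "\<And>Y :: complex^'p^'p. rank (G ** Y) \<le> rank X" "\<And>Y :: complex^'n^'n. rank (Y ** G) \<le> rank X"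
    "\<And>P :: complex^'n^'n. P ** X = 0 \<Longrightarrow> P ** G = 0" "\<And>Q :: complex^'p^'p. X ** Q = 0 \<Longrightarrow> G ** Q = 0"
proof -
  obtain U d where X: "left_singular_decomp X U d" by (rule left_singular_decomp_exists)
  note D = left_singular_decompD[OF X]
  \<comment> \<open>As \<open>inverse 0 = 0\<close>, this is the pseudoinverse of the square root of
    \<open>X ** ct X\<close>. Likewise \<open>E\<close> projects onto the column space of
    \<open>X\<close>.\<close>
  define T where "T = U ** diag_matrix (\<lambda>i. inverse (d i)) ** ct U"
  define E where "E = U ** diag_matrix (\<lambda>i. of_bool (i \<in> {i. d i \<noteq> 0})) ** ct U"
  define G where "G = T ** X"
  have ctT: "ct T = T" by (simp add: T_def ct_mult matrix_mul_assoc)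
  have DU: "(U ** diag_matrix a ** ct U) ** (U ** diag_matrix b ** ct U) = U ** diag_matrix (\<lambda>i. a i * b i) ** ct U" for a b
    by (rule unitary_diag_mult[OF D(1)])
  have "ct G = ct X ** T" by (simp add: G_def ct_mult ctT)
  then have "G ** ct G = T ** (X ** ct X) ** T" by (simp add: G_def matrix_mul_assoc)
  also have "\<dots> = E"
    unfolding T_def E_def D(3) DU
    by (rule arg_cong[where f="\<lambda>f. U ** diag_matrix f ** ct U"]) (auto simp: field_simps power2_eq_square)
  finally have GG: "G ** ct G = E" .
  have EX: "E ** X = X"
  proof -
    have "diag_matrix (\<lambda>i. of_bool (i \<in> {i. d i \<noteq> 0})) ** (ct U ** X) = ct U ** X"
    proof -
      have "(ct U ** X) $ i = 0" if "d i = 0" for i using row_norm_decomp[OF X, of i] that by simp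
      then show ?thesis by (simp add: vec_eq_iff[of _ "ct U ** X"] diag_mult_row)
    qed
    then have "E ** X = U ** (ct U ** X)"
      unfolding E_def by (simp only: matrix_mul_assoc[symmetric])
    then show ?thesis using D(1) by (simp add: unitary_cancel)
  qed
  have ET: "E ** T = T"
    unfolding T_def E_def DU
    by (rule arg_cong[where f="\<lambda>f. U ** diag_matrix f ** ct U"]) auto
  have EG: "E ** G = G" unfolding G_def by (simp add: matrix_mul_assoc ET)
  have XGG: "X ** ct G ** G = X"
  proof -
    have "X ** ct G ** G = ((X ** ct X) ** T ** T) ** X"
      unfolding G_def by (simp add: ct_mult ctT matrix_mul_assoc)
    also have "(X ** ct X) ** T ** T = E"
      unfolding T_def E_def D(3) DU
      by (rule arg_cong[where f="\<lambda>f. U ** diag_matrix f ** ct U"]) (auto simp: field_simps power2_eq_square)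
    finally show ?thesis by (simp add: EX)
  qed
  have inner: "X \<bullet> ((U ** diag_matrix w ** ct U) ** X) = (\<Sum>i\<in>UNIV. w i * (d i)\<^sup>2)" for w
    by (simp add: inner_unitary_diag[OF D(1)] row_norm_decomp[OF X] flip: power2_norm_eq_inner)
  have XG: "X \<bullet> G = nuclear_norm X"
  proof -
    have "inverse (d i) * (d i)\<^sup>2 = d i" for i
      by (cases "d i = 0") (simp_all add: power2_eq_square)
    then show ?thesis unfolding G_def T_def inner by (simp add: nuclear_norm_eq[OF X])
  qed
  have "(norm G)\<^sup>2 = X \<bullet> (T ** T ** X)"
    by (simp add: power2_norm_eq_inner G_def inner_mult_left ctT matrix_mul_assoc)
  also have "\<dots> = (\<Sum>i\<in>UNIV. inverse (d i) * inverse (d i) * (d i)\<^sup>2)"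
    unfolding T_def DU inner ..
  also have "\<dots> = (\<Sum>i\<in>UNIV. of_bool (i \<in> {i. d i \<noteq> 0}))"
    by (intro sum.cong) (auto simp: power2_eq_square field_simps)
  also have "\<dots> = card {i. d i \<noteq> 0}" by (simp add: of_bool_def sum.If_cases)
  also have "\<dots> \<le> rank X" using card_singular_values_le_rank[OF X] by simp
  finally have nG: "(norm G)\<^sup>2 \<le> real (rank X)" by simp
  have rGY: "rank (G ** Y) \<le> rank X" for Y :: "complex^'p^'p"
  proof -
    have "G ** Y = E ** G ** Y" by (simp add: EG)
    also have "\<dots> = U ** diag_matrix (\<lambda>i. of_bool (i \<in> {i. d i \<noteq> 0})) ** (ct U ** G ** Y)"
      by (simp only: E_def matrix_mul_assoc)
    also have "rank \<dots> \<le> card {i. d i \<noteq> 0}" by (rule rank_diag_mult_le)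
    finally show ?thesis using card_singular_values_le_rank[OF X] by linarith
  qed
  have rYG: "rank (Y ** G) \<le> rank X" for Y :: "complex^'n^'n"
    unfolding G_def matrix_mul_assoc by (rule rank_mult_le_right)
  have PG: "P ** G = 0" if "P ** X = 0" for P :: "complex^'n^'n"
  proof -
    \<comment> \<open>This puts a factor \<open>X\<close> at the left end of \<open>G\<close>, where
      \<open>P\<close> can annihilate it.\<close>
    have "X ** ct X ** T ** T ** T = T"
      unfolding T_def D(3) DU
      by (rule arg_cong[where f="\<lambda>f. U ** diag_matrix f ** ct U"]) (auto simp: field_simps power2_eq_square)
    then have "P ** G = P ** (X ** ct X ** T ** T ** T) ** X" by (simp add: G_def matrix_mul_assoc)
    also have "\<dots> = P ** X ** (ct X ** T ** T ** T ** X)" by (simp only: matrix_mul_assoc)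
    finally show ?thesis using that by simp
  qed
  have GQ: "G ** Q = 0" if "X ** Q = 0" for Q :: "complex^'p^'p"
    using that unfolding G_def by (simp only: matrix_mul_assoc[symmetric] matrix_zero_right)
  show ?thesis
    using that[of G] GG EG EX XGG XG nG rGY rYG PG GQ by simp
qed

lemma nuclear_norm_triangle: "nuclear_norm (A + B) \<le> nuclear_norm A + nuclear_norm B"
proof -
  obtain G where G: "G ** ct G ** G = G" "(A + B) \<bullet> G = nuclear_norm (A + B)"
    by (rule polar_factor[of "A + B"])
  note c = contraction_inner_le[OF contraction_if_partial_isometry[OF G(1)]]
  show ?thesis using c[of A] c[of B] G(2) by (simp add: inner_commute inner_add_right)
qed

lemma nuclear_norm_le_rank: "nuclear_norm A \<le> sqrt (real (rank A)) * norm A"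
proof -
  obtain G where G: "(norm G)\<^sup>2 \<le> real (rank A)" "A \<bullet> G = nuclear_norm A"
    by (rule polar_factor[of A])
  have "nuclear_norm A \<le> norm A * norm G" unfolding G(2)[symmetric] by (rule norm_cauchy_schwarz)
  also have "\<dots> \<le> norm A * sqrt (real (rank A))"
    using G(1) by (intro mult_left_mono real_le_rsqrt) auto
  finally show ?thesis by (simp add: mult.commute)
qed

section \<open>Restricted isometry and stability\<close>

lemma complex_linear_imp_linear:
  assumes "complex_linear S" shows "linear S"
proof (rule linearI)
  interpret Vector_Spaces.linear "\<lambda>c. map_matrix ((*) c)" "(*s)" S
    using assms by (simp add: complex_linear_def)
  show "S (A + B) = S A + S B" for A B by (rule add)
  show "S (c *\<^sub>R A) = c *\<^sub>R S A" for c A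
  proof -
    have "map_matrix ((*) (complex_of_real c)) A = c *\<^sub>R A"
      by (simp add: vec_eq_iff scaleR_conv_of_real[where 'a=complex])
    then have "S (c *\<^sub>R A) = complex_of_real c *s S A" using scale[of "of_real c" A] by simp
    then show ?thesis by (simp add: vec_eq_iff scaleR_conv_of_real[where 'a=complex])
  qed
qed

text \<open>The infimum in \<open>ric\<close> satisfies its own defining inequalities: for each
  nonzero \<open>X\<close> both of them bound \<delta> from below by a quotient free of \<delta>,
  and lower bounds pass to the infimum.\<close>

lemma ric_bounds:
  fixes S :: "complex^'p^'n \<Rightarrow> complex^'m"
  assumes S: "linear S"
  shows ric_nonneg: "0 \<le> ric S k"
    and ric_lower: "rank X \<le> k \<Longrightarrow> (1 - ric S k) * (norm X)\<^sup>2 \<le> (norm (S X))\<^sup>2"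
    and ric_upper: "rank X \<le> k \<Longrightarrow> (norm (S X))\<^sup>2 \<le> (1 + ric S k) * (norm X)\<^sup>2"
proof -
  define D where "D = {\<delta>. 0 \<le> \<delta> \<and> (\<forall>X. rank X \<le> k \<longrightarrow>
     (1 - \<delta>) * (norm X)\<^sup>2 \<le> (norm (S X))\<^sup>2 \<and> (norm (S X))\<^sup>2 \<le> (1 + \<delta>) * (norm X)\<^sup>2)}"
  have ric: "ric S k = Inf D" by (simp add: ric_def D_def)
  obtain C where C: "\<And>X. norm (S X) \<le> C * norm X"
    using linear_bounded[OF S] by blast
  \<comment> \<open>The infimum ranges over a nonempty set: for this constant the upper inequality
    follows from boundedness of \<open>S\<close>, and the left side of the lower one is
    nonpositive.\<close>
  have "1 + C\<^sup>2 \<in> D"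
  proof -
    have "(norm (S X))\<^sup>2 \<le> C\<^sup>2 * (norm X)\<^sup>2" for X
      using power_mono[OF C[of X], of 2] by (simp add: power_mult_distrib)
    moreover have "C\<^sup>2 * (norm X)\<^sup>2 \<le> (1 + (1 + C\<^sup>2)) * (norm X)\<^sup>2" for X :: "complex^'p^'n"
      by (intro mult_right_mono) auto
    ultimately have upper: "(norm (S X))\<^sup>2 \<le> (1 + (1 + C\<^sup>2)) * (norm X)\<^sup>2" for X
      by (rule order_trans)
    have "(1 - (1 + C\<^sup>2)) * (norm X)\<^sup>2 \<le> (norm (S X))\<^sup>2" for X
      by (rule order_trans[of _ 0]) (simp_all add: mult_nonpos_nonneg)
    with upper show ?thesis by (simp add: D_def)
  qed
  then have D: "D \<noteq> {}" by auto
  show "0 \<le> ric S k" unfolding ric by (rule cInf_greatest[OF D]) (simp add: D_def)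
  assume X: "rank X \<le> k"
  show "(1 - ric S k) * (norm X)\<^sup>2 \<le> (norm (S X))\<^sup>2"
  proof (cases "X = 0")
    case False
    have "1 - (norm (S X))\<^sup>2 / (norm X)\<^sup>2 \<le> ric S k"
      unfolding ric using False X by (intro cInf_greatest[OF D]) (auto simp: D_def field_simps)
    then show ?thesis using False by (simp add: field_simps)
  qed simp
  show "(norm (S X))\<^sup>2 \<le> (1 + ric S k) * (norm X)\<^sup>2"
  proof (cases "X = 0")
    case True
    then show ?thesis using linear_0[OF S] by simp
  next
    case False
    have "(norm (S X))\<^sup>2 / (norm X)\<^sup>2 - 1 \<le> ric S k"
      unfolding ric using False X by (intro cInf_greatest[OF D]) (auto simp: D_def field_simps)
    then show ?thesis using False by (simp add: field_simps)
  qed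
qed

text \<open>Polarization: after normalization the sum and the difference of the two orthogonal
  matrices both have squared norm 2 and rank at most \<open>k\<close>.\<close>

lemma ric_inner:
  fixes S :: "complex^'p^'n \<Rightarrow> complex^'m"
  assumes S: "linear S" and orth: "A \<bullet> B = 0" and rank: "rank A + rank B \<le> k"
  shows "- (S A \<bullet> S B) \<le> ric S k * norm A * norm B"
proof (cases "A = 0 \<or> B = 0")
  case True
  then show ?thesis using linear_0[OF S] by auto
next
  case False
  define A' where "A' = (1 / norm A) *\<^sub>R A"
  define B' where "B' = (1 / norm B) *\<^sub>R B"
  have n: "(norm A')\<^sup>2 = 1" "(norm B')\<^sup>2 = 1" using False by (auto simp: A'_def B'_def)
  have o: "A' \<bullet> B' = 0" using orth by (simp add: A'_def B'_def)
  have r: "rank A' + rank B' \<le> k"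
    unfolding A'_def B'_def using rank rank_scaleR_le[of "1 / norm A" A] rank_scaleR_le[of "1 / norm B" B] by linarith
  have n2: "(norm (A' + B'))\<^sup>2 = 2" "(norm (A' - B'))\<^sup>2 = 2"
    using n o by (auto simp: power2_norm_eq_inner inner_add_left inner_add_right inner_diff_left
        inner_diff_right inner_commute[of B' A'])
  have "(norm (S (A' - B')))\<^sup>2 \<le> (1 + ric S k) * 2"
    using ric_upper[OF S, of "A' - B'" k] rank_diff_le[of A' B'] r n2 by simp
  moreover have "(1 - ric S k) * 2 \<le> (norm (S (A' + B')))\<^sup>2"
    using ric_lower[OF S, of "A' + B'" k] rank_add_le[of A' B'] r n2 by simp
  moreover have "(norm (S (A' + B')))\<^sup>2 - (norm (S (A' - B')))\<^sup>2 = 4 * (S A' \<bullet> S B')"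
    by (simp add: linear_add[OF S] linear_diff[OF S] power2_norm_eq_inner inner_add_left inner_add_right
        inner_diff_left inner_diff_right inner_commute[of "S B'" "S A'"])
  ultimately have "- (S A' \<bullet> S B') \<le> ric S k" by argo
  moreover have "S A' \<bullet> S B' = (S A \<bullet> S B) / (norm A * norm B)"
    by (simp add: A'_def B'_def linear_scale[OF S])
  ultimately show ?thesis using False by (simp add: field_simps)
qed

section \<open>Splitting into blocks of singular values\<close>

lemma exists_top_subset:
  fixes d :: "'a \<Rightarrow> 'b::linorder"
  assumes "finite I" "K \<le> card I"
  shows "\<exists>B\<subseteq>I. card B = K \<and> (\<forall>b\<in>B. \<forall>i\<in>I - B. d i \<le> d b)"
  using assms(2)
proof (induction K)
  case 0
  show ?case by (rule exI[of _ "{}"]) auto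
next
  case (Suc K)
  then obtain B where B: "B \<subseteq> I" "card B = K" "\<forall>b\<in>B. \<forall>i\<in>I - B. d i \<le> d b" by auto
  have fin: "finite B" "finite (I - B)" using B(1) assms(1) finite_subset by auto
  have "I - B \<noteq> {}" using Suc.prems B card_mono[OF fin(1), of I] by auto
  then obtain m where m: "m \<in> I - B" "\<forall>i\<in>I - B. d i \<le> d m"
  proof -
    have "Max (d ` (I - B)) \<in> d ` (I - B)" using fin(2) \<open>I - B \<noteq> {}\<close> by (intro Max_in) auto
    then show ?thesis using that fin(2) by (metis Max_ge finite_imageI imageE imageI)
  qed
  have "card (insert m B) = Suc K" using B(2) m(1) fin(1) by simp
  then show ?case using B m by (intro exI[of _ "insert m B"]) auto
qed

lemma sum_power2_le_card_bound:
  fixes d :: "'a \<Rightarrow> real"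
  assumes "finite B" "card B \<le> K" "0 \<le> c" "\<And>i. i \<in> B \<Longrightarrow> 0 \<le> d i \<and> d i \<le> c"
  shows "sqrt (\<Sum>i\<in>B. (d i)\<^sup>2) \<le> sqrt (real K) * c"
proof -
  have "(\<Sum>i\<in>B. (d i)\<^sup>2) \<le> real (card B) * c\<^sup>2"
    using assms by (intro sum_bounded_above) (auto intro: power_mono)
  also have "\<dots> \<le> real K * c\<^sup>2" using assms by (intro mult_right_mono) auto
  finally have "sqrt (\<Sum>i\<in>B. (d i)\<^sup>2) \<le> sqrt (real K * c\<^sup>2)" by (rule real_sqrt_le_mono)
  then show ?thesis using assms(3) by (simp add: real_sqrt_mult)
qed

text \<open>The usual decomposition into blocks of decreasing size, done greedily: the entries outside
  the top block are bounded by its smallest entry, hence by its average.\<close>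

lemma block_bound:
  fixes d :: "'a \<Rightarrow> real" and L :: "'a set \<Rightarrow> real"
  assumes K: "0 < K" and \<beta>: "0 \<le> \<beta>" and "finite I" "\<And>i. 0 \<le> d i"
    and add: "\<And>A B. A \<inter> B = {} \<Longrightarrow> A \<union> B \<subseteq> I \<Longrightarrow> L (A \<union> B) \<le> L A + L B"
    and small: "\<And>B. B \<subseteq> I \<Longrightarrow> card B \<le> K \<Longrightarrow> L B \<le> \<beta> * sqrt (\<Sum>i\<in>B. (d i)\<^sup>2)"
    and "0 \<le> c" "\<And>i. i \<in> I \<Longrightarrow> d i \<le> c"
  shows "L I \<le> \<beta> * (sqrt (real K) * c + (\<Sum>i\<in>I. d i) / sqrt (real K))"
proof -
  \<comment> \<open>The bound \<open>c\<close> is generalized along with the set, because it shrinks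
    to the least entry of each block that is split off.\<close>
  have "L J \<le> \<beta> * (sqrt (real K) * c + (\<Sum>i\<in>J. d i) / sqrt (real K))"
    if "J \<subseteq> I" "0 \<le> c" "\<And>i. i \<in> J \<Longrightarrow> d i \<le> c" for J c
    using finite_subset[OF that(1) \<open>finite I\<close>] that
  proof (induction J arbitrary: c rule: finite_psubset_induct)
    case (psubset J)
    show ?case
    proof (cases "card J \<le> K")
      case True
      then have "L J \<le> \<beta> * sqrt (\<Sum>i\<in>J. (d i)\<^sup>2)" using psubset by (intro small)
      also have "\<dots> \<le> \<beta> * (sqrt (real K) * c)"
        using psubset \<beta> True assms(4) by (intro mult_left_mono sum_power2_le_card_bound) auto
      also have "\<dots> \<le> \<beta> * (sqrt (real K) * c + (\<Sum>i\<in>J. d i) / sqrt (real K))"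
        using \<beta> assms(4) by (intro mult_left_mono) (auto intro!: divide_nonneg_nonneg sum_nonneg)
      finally show ?thesis .
    next
      case False
      then obtain B where B: "B \<subseteq> J" "card B = K" "\<forall>b\<in>B. \<forall>i\<in>J - B. d i \<le> d b"
        using exists_top_subset[OF psubset.hyps, of K d] by auto
      have finB: "finite B" using B(1) psubset.hyps finite_subset by blast
      have "B \<noteq> {}" using B(2) K by auto
      define m where "m = Min (d ` B)"
      have m: "m \<in> d ` B" "\<And>b. b \<in> B \<Longrightarrow> m \<le> d b"
        using finB \<open>B \<noteq> {}\<close> by (auto simp: m_def)
      have Km: "real K * m \<le> (\<Sum>i\<in>B. d i)" using sum_bounded_below[of B m d] m(2) B(2) by simp
      have "L J \<le> L B + L (J - B)"
        using add[of B "J - B"] B(1) psubset.prems(1) by (simp add: Un_absorb1 Un_Diff_cancel)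
      moreover have "L B \<le> \<beta> * (sqrt (real K) * c)"
      proof -
        have "L B \<le> \<beta> * sqrt (\<Sum>i\<in>B. (d i)\<^sup>2)" using psubset.prems B by (intro small) auto
        also have "\<dots> \<le> \<beta> * (sqrt (real K) * c)"
          using psubset.prems B finB \<beta> assms(4) by (intro mult_left_mono sum_power2_le_card_bound) auto
        finally show ?thesis .
      qed
      moreover have "L (J - B) \<le> \<beta> * (sqrt (real K) * m + (\<Sum>i\<in>J - B. d i) / sqrt (real K))"
        using B \<open>B \<noteq> {}\<close> m(1) psubset.prems(1) assms(4) by (intro psubset.IH) auto
      \<comment> \<open>The sum over the removed block \<open>B\<close> is at least
        \<open>K * m\<close>, which pays for the term \<open>sqrt (real K) * m\<close> of the
        induction hypothesis.\<close>
      moreover have "\<beta> * (sqrt (real K) * m + (\<Sum>i\<in>J - B. d i) / sqrt (real K)) \<le>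
          \<beta> * ((\<Sum>i\<in>J. d i) / sqrt (real K))"
      proof (intro mult_left_mono \<beta>)
        have "sqrt (real K) * m = (real K * m) / sqrt (real K)"
          using K by (simp add: real_div_sqrt field_simps)
        also have "\<dots> \<le> (\<Sum>i\<in>B. d i) / sqrt (real K)" using Km by (intro divide_right_mono) auto
        finally show "sqrt (real K) * m + (\<Sum>i\<in>J - B. d i) / sqrt (real K) \<le> (\<Sum>i\<in>J. d i) / sqrt (real K)"
          using sum.subset_diff[OF B(1) psubset.hyps, of d] by (simp add: add_divide_distrib)
      qed
      ultimately show ?thesis by (simp add: algebra_simps)
    qed
  qed
  then show ?thesis using assms by blast
qed

text \<open>The part \<open>\<Sum>i\<in>I. \<sigma>\<^sub>i u\<^sub>i v\<^sub>i\<^sup>*\<close> of a singular value decomposition of \<open>H\<close> with left singular vectors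
  the columns of \<open>U\<close>.\<close>

definition singular_block :: "complex^'n^'n \<Rightarrow> 'n set \<Rightarrow> complex^'p^'n \<Rightarrow> complex^'p^'n" where
  "singular_block U I H = U ** diag_matrix (\<lambda>i. of_bool (i \<in> I)) ** ct U ** H"

lemma singular_block_assoc:
  "singular_block U I H = U ** (diag_matrix (\<lambda>i. of_bool (i \<in> I)) ** (ct U ** H))"
  by (simp add: singular_block_def matrix_mul_assoc)

lemma singular_block_Un:
  assumes "I \<inter> J = {}" shows "singular_block U (I \<union> J) H = singular_block U I H + singular_block U J H"
proof -
  have "diag_matrix (\<lambda>i. of_bool (i \<in> I \<union> J)) ** (ct U ** H) =
      diag_matrix (\<lambda>i. of_bool (i \<in> I)) ** (ct U ** H) + diag_matrix (\<lambda>i. of_bool (i \<in> J)) ** (ct U ** H)"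
    using assms by (auto simp: vec_eq_iff diag_mult_nth)
  then show ?thesis by (simp add: singular_block_assoc matrix_add_ldistrib)
qed

lemma singular_block_UNIV: "unitary U \<Longrightarrow> singular_block U UNIV H = H"
  by (simp add: singular_block_assoc diag_1 unitary_cancel)

lemma singular_block_norm:
  assumes H: "left_singular_decomp H U d" shows "norm (singular_block U I H) = sqrt (\<Sum>i\<in>I. (d i)\<^sup>2)"
proof -
  have "(norm (singular_block U I H))\<^sup>2 = (\<Sum>i\<in>UNIV. (of_bool (i \<in> I) * d i)\<^sup>2)"
    by (simp add: singular_block_assoc norm_mult_unitary_left[OF left_singular_decompD(1)[OF H]]
        norm_sq_rows[of "_ ** _"] diag_mult_row row_norm_decomp[OF H])
  also have "\<dots> = (\<Sum>i\<in>I. (d i)\<^sup>2)"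
    by (intro sum.mono_neutral_cong_right) auto
  finally show ?thesis by (metis norm_ge_zero real_sqrt_unique)
qed

lemma singular_block_inner:
  assumes U: "unitary U" and "I \<inter> J = {}" shows "singular_block U I H \<bullet> singular_block U J H = 0"
proof -
  have "singular_block U I H \<bullet> singular_block U J H =
      (\<Sum>i\<in>UNIV. of_bool (i \<in> I) * (of_bool (i \<in> J) * ((ct U ** H) $ i \<bullet> (ct U ** H) $ i)))"
    unfolding singular_block_assoc inner_unitary[OF U]
    by (simp add: inner_vec_def[of "_ ** _"] diag_mult_row mult_ac del: sum_of_bool_mult_eq sum_mult_of_bool_eq)
  also have "\<dots> = 0" using assms(2) by (intro sum.neutral) auto
  finally show ?thesis .
qed

lemma rank_singular_block_le: "rank (singular_block U I H) \<le> card I"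
  unfolding singular_block_def matrix_mul_assoc[symmetric, of _ "ct U" H] by (rule rank_diag_mult_le)

text \<open>The polar factors \<open>G\<close> of \<open>X\<close> and \<open>F\<close> of
  \<open>H\<close> have orthogonal row and column spaces, so \<open>G + F\<close> is again a partial
  isometry. Pairing it with \<open>X + H\<close> gives both nuclear norms at once.\<close>

lemma nuclear_norm_add_orthogonal:
  fixes G X H :: "complex^'p^'n"
  assumes G: "G ** ct G ** G = G" "G ** ct G ** X = X" "X \<bullet> G = nuclear_norm X"
    and H: "G ** ct G ** H = 0" "H ** ct G ** G = 0"
  shows "nuclear_norm X + nuclear_norm H \<le> nuclear_norm (X + H)"
proof -
  obtain F where F: "F ** ct F ** F = F" "H \<bullet> F = nuclear_norm H"
    "\<And>P :: complex^'n^'n. P ** H = 0 \<Longrightarrow> P ** F = 0" "\<And>Q :: complex^'p^'p. H ** Q = 0 \<Longrightarrow> F ** Q = 0"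
    by (rule polar_factor[of H]) blast
  have 1: "G ** ct G ** F = 0" using F(3) H(1) by (simp add: matrix_mul_assoc)
  have 2: "F ** ct G ** G = 0" using F(4)[of "ct G ** G"] H(2) by (simp add: matrix_mul_assoc)
  have ctG: "ct G ** G ** ct G = ct G" using arg_cong[OF G(1), of ct] by (simp add: ct_mult matrix_mul_assoc)
  have 3: "ct G ** F = 0"
  proof -
    have "ct G ** F = ct G ** (G ** ct G ** F)" using ctG by (simp add: matrix_mul_assoc)
    then show ?thesis by (simp add: 1)
  qed
  have 4: "F ** ct G = 0"
  proof -
    have "F ** ct G = F ** (ct G ** G ** ct G)" by (simp only: ctG)
    then show ?thesis by (simp add: 2 matrix_mul_assoc)
  qed
  have 5: "ct F ** G = 0" using arg_cong[OF 3, of ct] by (simp add: ct_mult)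
  have 6: "G ** ct F = 0" using arg_cong[OF 4, of ct] by (simp add: ct_mult)
  have "(G + F) ** ct (G + F) ** (G + F) = G + F"
    using G(1) F(1) by (simp add: ct_add matrix_distribs 3 4 5 6 matrix_mul_assoc[symmetric])
  then have "(G + F) \<bullet> (X + H) \<le> nuclear_norm (X + H)"
    by (intro contraction_inner_le contraction_if_partial_isometry)
  moreover have "F \<bullet> X = 0"
  proof -
    have "X \<bullet> F = (G ** (ct G ** X)) \<bullet> F" using G(2) by (simp add: matrix_mul_assoc)
    also have "\<dots> = 0" unfolding inner_mult_left 3 by simp
    finally show ?thesis by (simp add: inner_commute)
  qed
  moreover have "G \<bullet> H = 0"
  proof -
    have "G \<bullet> H = (G ** ct G ** G) \<bullet> H" by (simp add: G(1))
    also have "\<dots> = G \<bullet> (G ** ct G ** H)"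
      using inner_mult_left[of "G ** ct G" G H] by (simp add: ct_mult)
    finally show ?thesis by (simp add: H(1))
  qed
  ultimately show ?thesis
    using G(3) F(2) by (simp add: inner_add_left inner_add_right inner_commute)
qed

text \<open>The column and row spaces of a singular block lie in those of \<open>H\<close>, and
  these are orthogonal to those of \<open>G\<close>.\<close>

lemma singular_block_orthogonal:
  assumes H: "left_singular_decomp H U d" and GH: "G ** ct G ** H = 0" "H ** ct G ** G = 0"
    and G: "G ** ct G ** G = G" and B: "B = singular_block U I H"
  shows "ct G ** B = 0" "B ** ct G = 0"
proof -
  note D = left_singular_decompD[OF H]
  have ctG: "ct G ** G ** ct G = ct G" using arg_cong[OF G, of ct] by (simp add: ct_mult matrix_mul_assoc)
  have "B ** ct G = U ** diag_matrix (\<lambda>i. of_bool (i \<in> I)) ** ct U ** (H ** ct G ** G) ** ct G"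
    using ctG by (simp add: B singular_block_def matrix_mul_assoc[symmetric])
  then show "B ** ct G = 0" by (simp add: GH(2))
  \<comment> \<open>\<open>R\<close> inverts \<open>H ** ct H\<close> on the nonzero singular
    directions in \<open>I\<close>, so that \<open>B\<close> can be written with a factor
    \<open>H\<close> at its left end.\<close>
  define R where "R = U ** diag_matrix (\<lambda>i. of_bool (i \<in> I) * inverse ((d i)\<^sup>2)) ** ct U"
  have zero: "(ct U ** H) $ i = 0" if "d i = 0" for i using row_norm_decomp[OF H, of i] that by simp
  have "(H ** ct H) ** R ** H = U ** (diag_matrix (\<lambda>i. (d i)\<^sup>2 * (of_bool (i \<in> I) * inverse ((d i)\<^sup>2))) ** (ct U ** H))"
    unfolding R_def D(3) unitary_diag_mult[OF D(1)] by (simp only: matrix_mul_assoc)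
  also have "diag_matrix (\<lambda>i. (d i)\<^sup>2 * (of_bool (i \<in> I) * inverse ((d i)\<^sup>2))) ** (ct U ** H) =
      diag_matrix (\<lambda>i. of_bool (i \<in> I)) ** (ct U ** H)"
  proof -
    have "((d i)\<^sup>2 * (of_bool (i \<in> I) * inverse ((d i)\<^sup>2))) *\<^sub>R (ct U ** H) $ i =
        of_bool (i \<in> I) *\<^sub>R (ct U ** H) $ i" for i
      using zero[of i] by (cases "d i = 0") simp_all
    then show ?thesis by (simp only: vec_eq_iff[of "_ ** _"] diag_mult_row) simp
  qed
  finally have "B = (H ** ct H) ** R ** H" by (simp add: B singular_block_def matrix_mul_assoc)
  then have "ct G ** B = ct G ** (G ** ct G ** H) ** ct H ** R ** H"
    using ctG by (simp add: matrix_mul_assoc)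
  then show "ct G ** B = 0" by (simp add: GH(1))
qed

text \<open>Recht, Fazel and Parrilo's splitting of \<open>H\<close> relative to \<open>X\<close>: \<open>H\<^sub>c\<close> is the part of \<open>H\<close> with
  column and row space orthogonal to those of \<open>X\<close>.\<close>

lemma orthogonal_splitting:
  fixes X H :: "complex^'p^'n"
  obtains H0 Hc where "H = H0 + Hc" "rank H0 \<le> 2 * rank X"
    "nuclear_norm X + nuclear_norm Hc \<le> nuclear_norm (X + Hc)"
    "\<And>U d I. left_singular_decomp Hc U d \<Longrightarrow>
      H0 \<bullet> singular_block U I Hc = 0"
proof -
  obtain G where G: "G ** ct G ** G = G" "G ** ct G ** X = X" "X \<bullet> G = nuclear_norm X"
    "\<And>Y :: complex^'p^'p. rank (G ** Y) \<le> rank X" "\<And>Y :: complex^'n^'n. rank (Y ** G) \<le> rank X"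
    by (rule polar_factor[of X]) blast
  have ctG: "ct G ** G ** ct G = ct G" using arg_cong[OF G(1), of ct] by (simp add: ct_mult matrix_mul_assoc)
  \<comment> \<open>With the projections \<open>P\<close> and \<open>Q = ct G ** G\<close>,
    \<open>H\<close> is split into \<open>P H\<close>, \<open>(1 - P) H Q\<close> and
    \<open>(1 - P) H (1 - Q)\<close>. Each of the first two has a factor \<open>G\<close>, hence
    rank at most that of \<open>X\<close>; together they form \<open>H0\<close>.\<close>
  define P where "P = G ** ct G"
  define Hc where "Hc = (mat 1 - P) ** H ** (mat 1 - ct G ** G)"
  define Y where "Y = (mat 1 - P) ** H ** ct G"
  define H0 where "H0 = G ** (ct G ** H) + Y ** G"
  have H: "H = H0 + Hc"
    unfolding H0_def Hc_def Y_def P_def by (simp add: matrix_distribs matrix_mul_assoc algebra_simps)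
  have PP: "P ** (mat 1 - P) = 0" using G(1) by (simp add: P_def matrix_distribs matrix_mul_assoc)
  have QQ: "(mat 1 - ct G ** G) ** (ct G ** G) = 0" using ctG by (simp add: matrix_distribs matrix_mul_assoc)
  have GHc: "G ** ct G ** Hc = 0"
    using PP by (simp add: Hc_def matrix_mul_assoc flip: P_def)
  have "Hc ** (ct G ** G) = 0"
    unfolding Hc_def using QQ by (simp only: matrix_mul_assoc[symmetric] matrix_zero_right)
  then have HcG: "Hc ** ct G ** G = 0" by (simp add: matrix_mul_assoc)
  have "rank H0 \<le> 2 * rank X"
    unfolding H0_def using rank_add_le[of "G ** (ct G ** H)" "Y ** G"] G(4)[of "ct G ** H"] G(5)[of Y] by linarith
  moreover have "H0 \<bullet> singular_block U I Hc = 0"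
    if "left_singular_decomp Hc U d" for U d I
    unfolding H0_def inner_add_left inner_mult_left[of G "ct G ** H"] inner_mult_right[of Y G]
    using singular_block_orthogonal[OF that GHc HcG G(1) refl, of I] by simp
  ultimately show ?thesis
    using that[OF H] nuclear_norm_add_orthogonal[OF G(1,2,3) GHc HcG] by blast
qed

text \<open>\<open>J\<close> collects the \<open>K\<close> largest entries and \<open>c\<close> is
  the least of them; if there are at most \<open>K\<close> entries, \<open>J\<close> is everything
  and \<open>c = 0\<close>.\<close>

lemma exists_head_block:
  fixes d :: "'n::finite \<Rightarrow> real"
  assumes K: "0 < K" and d: "\<And>i. 0 \<le> d i"
  obtains J c where "card J \<le> K" "0 \<le> c" "\<And>i. i \<notin> J \<Longrightarrow> d i \<le> c" "real K * c \<le> (\<Sum>i\<in>J. d i)"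
proof (cases "CARD('n) \<le> K")
  case True
  then show ?thesis using that[of UNIV 0] d by (simp add: sum_nonneg)
next
  case False
  then obtain J where J: "card J = K" "\<forall>b\<in>J. \<forall>i\<in>UNIV - J. d i \<le> d b"
    using exists_top_subset[of "UNIV :: 'n set" K d] by auto
  have "J \<noteq> {}" using J(1) K by auto
  then have c: "Min (d ` J) \<in> d ` J" "\<And>b. b \<in> J \<Longrightarrow> Min (d ` J) \<le> d b" by auto
  show ?thesis
    using J c d sum_bounded_below[of J "Min (d ` J)" d] by (intro that[of J "Min (d ` J)"]) auto
qed

text \<open>\<open>Z - X\<close> lies in the kernel of \<open>S\<close>. Its part \<open>A\<close>,
  made of \<open>H0\<close> and the head of \<open>Hc\<close>, has rank at most
  \<open>3 * K\<close>, and the isometry bounds control it by the nuclear norm \<open>N\<close> of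
  \<open>Hc\<close>. Additivity of the nuclear norm on \<open>X + Hc\<close> bounds
  \<open>(1 - \<eta>) * N\<close> by the excess of \<open>nuclear_norm Z\<close> over
  \<open>nuclear_norm X\<close>.\<close>

theorem rip_implies_nuclear_norm_stability:
  fixes S :: "complex^'p^'n \<Rightarrow> complex^'m"
  assumes S: "linear S" and K: "0 < K" and X: "rank X \<le> K" and Z: "S Z = S X"
    and \<delta>: "ric S (3 * K) < 1" and \<eta>: "\<eta> = sqrt 2 * ric S (4 * K) / (1 - ric S (3 * K))" "\<eta> < 1"
  shows "norm (Z - X) \<le> (1 + \<eta>) / (sqrt (real K) * (1 - \<eta>)) * (nuclear_norm Z - nuclear_norm X)"
proof -
  define s where "s = sqrt (real K)"
  have s: "0 < s" "s * s = real K" using K by (auto simp: s_def)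
  obtain H0 Hc where H: "Z - X = H0 + Hc" "rank H0 \<le> 2 * rank X"
    "nuclear_norm X + nuclear_norm Hc \<le> nuclear_norm (X + Hc)"
    "\<And>U d I. left_singular_decomp Hc U d \<Longrightarrow>
      H0 \<bullet> singular_block U I Hc = 0"
    by (rule orthogonal_splitting[of "Z - X" X]) blast
  obtain U d where decomp: "left_singular_decomp Hc U d" by (rule left_singular_decomp_exists)
  note D = left_singular_decompD[OF decomp]
  define b where "b I = singular_block U I Hc" for I
  have b_Un: "b (I \<union> J) = b I + b J" if "I \<inter> J = {}" for I J
    unfolding b_def by (rule singular_block_Un[OF that])
  have b_UNIV: "b UNIV = Hc" unfolding b_def by (rule singular_block_UNIV[OF D(1)])
  have b_norm: "norm (b I) = sqrt (\<Sum>i\<in>I. (d i)\<^sup>2)" for I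
    unfolding b_def by (rule singular_block_norm[OF decomp])
  have b_orth: "b I \<bullet> b J = 0" if "I \<inter> J = {}" for I J
    unfolding b_def by (rule singular_block_inner[OF D(1) that])
  have b_rank: "rank (b I) \<le> card I" for I unfolding b_def by (rule rank_singular_block_le)
  have b_H0: "H0 \<bullet> b I = 0" for I unfolding b_def by (rule H(4)[OF decomp])
  obtain J c where J: "card J \<le> K" "0 \<le> c" "\<And>i. i \<notin> J \<Longrightarrow> d i \<le> c" "real K * c \<le> (\<Sum>i\<in>J. d i)"
    using exists_head_block[OF K, of d] D(2) by blast
  define N where "N = nuclear_norm Hc"
  \<comment> \<open>The head \<open>J\<close> pays for the term \<open>s * c\<close> of
    \<open>block_bound\<close>, so the total stays within the full nuclear norm of
    \<open>Hc\<close>.\<close>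
  have N: "s * c + (\<Sum>i\<in>- J. d i) / s \<le> N / s"
  proof -
    have "s * c = (real K * c) / s" using s by (simp add: field_simps)
    also have "\<dots> \<le> (\<Sum>i\<in>J. d i) / s" using J(4) s(1) by (intro divide_right_mono) auto
    finally have "s * c + (\<Sum>i\<in>- J. d i) / s \<le> ((\<Sum>i\<in>J. d i) + (\<Sum>i\<in>- J. d i)) / s"
      by (simp add: add_divide_distrib)
    also have "(\<Sum>i\<in>J. d i) + (\<Sum>i\<in>- J. d i) = N"
      using sum.subset_diff[of J UNIV d] by (simp add: N_def nuclear_norm_eq[OF decomp] Compl_eq_Diff_UNIV)
    finally show ?thesis .
  qed
  define A where "A = H0 + b J"
  have HA: "Z - X = A + b (- J)"
    using b_Un[of J "- J"] b_UNIV H(1) by (simp add: A_def)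
  then have SA: "S A = - S (b (- J))"
    using Z linear_diff[OF S, of Z X] linear_add[OF S, of A "b (- J)"] by (simp add: eq_neg_iff_add_eq_0)
  have rank_A: "rank A \<le> 3 * K"
    unfolding A_def using rank_add_le[of H0 "b J"] H(2) X b_rank[of J] J(1) by linarith
  \<comment> \<open>As \<open>S A = - S (b (- J))\<close>, the left side is the square of
    \<open>norm (S A)\<close>. A block of rank at most \<open>K\<close> is orthogonal to
    \<open>A\<close>, whose rank is at most \<open>3 * K\<close>; hence the constant
    \<open>ric S (4 * K)\<close>.\<close>
  have "- (S A \<bullet> S (b (- J))) \<le> ric S (4 * K) * norm A * (s * c + (\<Sum>i\<in>- J. d i) / s)"
    unfolding s_def
  proof (rule block_bound[OF K, where d = d and I = "- J" and L = "\<lambda>I. - (S A \<bullet> S (b I))"])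
    show "0 \<le> ric S (4 * K) * norm A" using ric_nonneg[OF S] by simp
    show "- (S A \<bullet> S (b (I1 \<union> I2))) \<le> - (S A \<bullet> S (b I1)) + - (S A \<bullet> S (b I2))" if "I1 \<inter> I2 = {}" for I1 I2
      by (simp add: b_Un[OF that] linear_add[OF S] inner_add_right)
    show "- (S A \<bullet> S (b B)) \<le> ric S (4 * K) * norm A * sqrt (\<Sum>i\<in>B. (d i)\<^sup>2)"
      if "B \<subseteq> - J" "card B \<le> K" for B
    proof -
      have "A \<bullet> b B = 0" unfolding A_def inner_add_left using that by (simp add: b_H0) (intro b_orth, auto)
      then show ?thesis
        unfolding b_norm[symmetric] using rank_A b_rank[of B] that(2) by (intro ric_inner[OF S]) auto
    qed
  qed (use J D in auto)
  also have "\<dots> \<le> ric S (4 * K) * norm A * (N / s)"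
    using N ric_nonneg[OF S] by (intro mult_left_mono) auto
  finally have "(norm (S A))\<^sup>2 \<le> ric S (4 * K) * norm A * (N / s)"
    by (simp add: SA power2_norm_eq_inner)
  then have "(1 - ric S (3 * K)) * (norm A)\<^sup>2 \<le> ric S (4 * K) * norm A * (N / s)"
    using ric_lower[OF S rank_A] by linarith
  then have bound: "norm A * ((1 - ric S (3 * K)) * norm A) \<le> norm A * (ric S (4 * K) * (N / s))"
    by (simp add: power2_eq_square mult_ac)
  have N0: "0 \<le> N" unfolding N_def by (rule nuclear_norm_nonneg)
  have "(1 - ric S (3 * K)) * norm A \<le> ric S (4 * K) * (N / s)"
  proof (cases "norm A = 0")
    case True
    then show ?thesis using s(1) N0 ric_nonneg[OF S, of "4 * K"] by simp
  next
    case False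
    then have "0 < norm A" by simp
    then show ?thesis using bound by (rule mult_left_le_imp_le[rotated])
  qed
  then have "norm A * (1 - ric S (3 * K)) \<le> ric S (4 * K) * (N / s)" by (simp only: mult.commute)
  then have "norm A \<le> ric S (4 * K) * (N / s) / (1 - ric S (3 * K))"
    using \<delta> by (intro mult_imp_le_div_pos) auto
  also have "\<dots> = \<eta> / sqrt 2 * (N / s)" by (simp add: \<eta>(1))
  finally have A: "norm A \<le> \<eta> / sqrt 2 * (N / s)" .
  have \<eta>0: "0 \<le> \<eta>" unfolding \<eta>(1) using \<delta> ric_nonneg[OF S] by simp
  have "norm (b (- J)) \<le> 1 * (s * c + (\<Sum>i\<in>- J. d i) / s)"
    unfolding s_def
  proof (rule block_bound[OF K, where d = d and I = "- J" and L = "\<lambda>I. norm (b I)"])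
    show "norm (b (I1 \<union> I2)) \<le> norm (b I1) + norm (b I2)" if "I1 \<inter> I2 = {}" for I1 I2
      unfolding b_Un[OF that] by (rule norm_triangle_ineq)
  qed (use J D in \<open>auto simp: b_norm\<close>)
  then have tail: "norm (b (- J)) \<le> N / s" using N by simp
  have "norm (Z - X) \<le> \<eta> / sqrt 2 * (N / s) + N / s"
    unfolding HA using norm_triangle_ineq[of A "b (- J)"] A tail by linarith
  also have "\<dots> \<le> \<eta> / 1 * (N / s) + N / s"
    using \<eta>0 N0 s(1) by (intro add_right_mono mult_right_mono divide_left_mono) auto
  finally have upper: "norm (Z - X) \<le> (1 + \<eta>) * (N / s)" by (simp add: algebra_simps add_divide_distrib)
  \<comment> \<open>The rank bound \<open>2 * K\<close> yields a factor \<open>sqrt 2\<close>, which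
    cancels the one in \<open>\<eta>\<close>. The result \<open>\<eta> * N\<close> can then be
    absorbed because \<open>\<eta> < 1\<close>.\<close>
  have "nuclear_norm H0 \<le> sqrt (real (rank H0)) * norm H0" by (rule nuclear_norm_le_rank)
  also have "\<dots> \<le> (sqrt 2 * s) * (\<eta> / sqrt 2 * (N / s))"
  proof (rule mult_mono)
    have "real (rank H0) \<le> 2 * real K" using H(2) X by linarith
    then show "sqrt (real (rank H0)) \<le> sqrt 2 * s"
      unfolding s_def real_sqrt_mult[symmetric] by (rule real_sqrt_le_mono)
    have "(norm H0)\<^sup>2 \<le> (norm A)\<^sup>2"
      by (simp add: A_def power2_norm_eq_inner inner_add_left inner_add_right b_H0 inner_commute[of "b J" H0])
    then show "norm H0 \<le> \<eta> / sqrt 2 * (N / s)" using A power2_le_imp_le[of "norm H0" "norm A"] by simp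
  qed (use s in auto)
  also have "\<dots> = \<eta> * N" using s by simp
  finally have H0: "nuclear_norm H0 \<le> \<eta> * N" .
  have "nuclear_norm (X + Hc) \<le> nuclear_norm Z + nuclear_norm H0"
  proof -
    have "X + Hc = Z + (- H0)" using H(1) by (simp add: algebra_simps)
    then show ?thesis using nuclear_norm_triangle[of Z "- H0"] by (simp add: nuclear_norm_minus)
  qed
  then have "(1 - \<eta>) * N \<le> nuclear_norm Z - nuclear_norm X"
    using H(3) H0 by (simp add: N_def algebra_simps)
  then have "N * (1 - \<eta>) \<le> nuclear_norm Z - nuclear_norm X" by (simp only: mult.commute)
  then have "N \<le> (nuclear_norm Z - nuclear_norm X) / (1 - \<eta>)"
    using \<eta>(2) by (intro mult_imp_le_div_pos) auto
  then have "(1 + \<eta>) * (N / s) \<le> (1 + \<eta>) * ((nuclear_norm Z - nuclear_norm X) / (1 - \<eta>) / s)"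
    using \<eta>0 s(1) by (intro mult_left_mono divide_right_mono) auto
  also have "\<dots> = (1 + \<eta>) / (s * (1 - \<eta>)) * (nuclear_norm Z - nuclear_norm X)"
    by (simp add: field_simps)
  finally show ?thesis using upper by (simp add: s_def)
qed

section \<open>The smoothed nuclear norm\<close>

text \<open>The value at \<open>t\<close> of \<open>min (t\<^sup>2 / m + m) / 2\<close> over all \<open>m \<ge> \<epsilon>\<close>, a Huber function.\<close>

definition huber :: "real \<Rightarrow> real \<Rightarrow> real" where
  "huber \<epsilon> t = (t\<^sup>2 / max t \<epsilon> + max t \<epsilon>) / 2"

lemma huber_eq: "0 < \<epsilon> \<Longrightarrow> huber \<epsilon> t = (if \<epsilon> \<le> t then t else (t\<^sup>2 / \<epsilon> + \<epsilon>) / 2)"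
  by (simp add: huber_def max_def power2_eq_square)

lemma huber_ge:
  assumes "0 < \<epsilon>" shows "t \<le> huber \<epsilon> t"
proof -
  have "0 \<le> (t - \<epsilon>)\<^sup>2 / \<epsilon>" using assms by simp
  also have "(t - \<epsilon>)\<^sup>2 / \<epsilon> = t\<^sup>2 / \<epsilon> + \<epsilon> - 2 * t"
    using assms by (simp add: divide_simps) algebra
  finally show ?thesis using assms by (simp add: huber_eq)
qed

lemma huber_le_add:
  assumes "0 < \<epsilon>" "0 \<le> t" shows "huber \<epsilon> t \<le> t + \<epsilon> / 2"
proof (cases "\<epsilon> \<le> t")
  case False
  then have "t\<^sup>2 / \<epsilon> \<le> t" using assms by (simp add: power2_eq_square pos_divide_le_eq mult_left_mono)
  then show ?thesis using False assms by (simp add: huber_eq)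
qed (use assms in \<open>simp add: huber_eq\<close>)

lemma huber_le_quadratic:
  assumes \<epsilon>: "0 < \<epsilon>" "\<epsilon> \<le> m" and t: "0 \<le> t"
  shows "huber \<epsilon> t \<le> (t\<^sup>2 / m + m) / 2"
proof (cases "\<epsilon> \<le> t")
  case True
  have "0 \<le> (t - m)\<^sup>2 / m" using \<epsilon> by simp
  also have "(t - m)\<^sup>2 / m = t\<^sup>2 / m + m - 2 * t"
    using \<epsilon> by (simp add: divide_simps) algebra
  finally show ?thesis using True \<epsilon> by (simp add: huber_eq)
next
  case False
  have "t\<^sup>2 \<le> m * \<epsilon>" using False \<epsilon> t mult_mono[of t m t \<epsilon>] by (simp add: power2_eq_square)
  then have "0 \<le> (m - \<epsilon>) * (m * \<epsilon> - t\<^sup>2) / (m * \<epsilon>)" using \<epsilon> by simp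
  also have "\<dots> = (t\<^sup>2 / m + m) - (t\<^sup>2 / \<epsilon> + \<epsilon>)"
    using \<epsilon> by (simp add: divide_simps) algebra
  finally show ?thesis using huber_eq[OF \<epsilon>(1), of t] False by simp
qed

text \<open>The Fenchel-Young inequality: on the unit interval the convex conjugate of the Huber
  function is \<open>- \<epsilon> / 2 * (1 - g\<^sup>2)\<close>.\<close>

lemma huber_fenchel:
  assumes \<epsilon>: "0 < \<epsilon>" and g: "0 \<le> g" "g \<le> 1"
  shows "g * t \<le> huber \<epsilon> t - \<epsilon> / 2 * (1 - g\<^sup>2)"
proof (cases "\<epsilon> \<le> t")
  case True
  have "\<epsilon> * (1 + g) \<le> t * 2" using True g \<epsilon> by (intro mult_mono) auto
  then have "0 \<le> (1 - g) * (t - \<epsilon> / 2 * (1 + g))" using g by (intro mult_nonneg_nonneg) auto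
  also have "\<dots> = t - \<epsilon> / 2 * (1 - g\<^sup>2) - g * t" by (simp add: power2_eq_square algebra_simps)
  finally show ?thesis using True \<epsilon> by (simp add: huber_eq)
next
  case False
  have "0 \<le> (t - \<epsilon> * g)\<^sup>2 / (2 * \<epsilon>)" using \<epsilon> by simp
  also have "\<dots> = (t\<^sup>2 / \<epsilon> + \<epsilon>) / 2 - \<epsilon> / 2 * (1 - g\<^sup>2) - g * t"
    using \<epsilon> by (simp add: divide_simps) algebra
  finally show ?thesis using False \<epsilon> by (simp add: huber_eq)
qed

text \<open>Equality in Fenchel-Young at the slope \<open>g = t / max t \<epsilon>\<close>, which is
  the weight of the algorithm times \<open>t\<close>.\<close>

lemma huber_fenchel_eq:
  assumes "0 < \<epsilon>"
  shows "huber \<epsilon> t = inverse (max t \<epsilon>) * t\<^sup>2 + \<epsilon> / 2 * (1 - (inverse (max t \<epsilon>) * t)\<^sup>2)"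
proof (cases "\<epsilon> \<le> t")
  case True
  then show ?thesis using assms by (simp add: huber_eq max_def power2_eq_square)
next
  case False
  then show ?thesis using assms by (simp add: huber_eq max_def power2_eq_square divide_simps)
qed

section \<open>The smoothed functional, its majorization and its subgradients\<close>

definition smoothed_nuclear_norm :: "real \<Rightarrow> complex^'p^'n \<Rightarrow> real" where
  "smoothed_nuclear_norm \<epsilon> X = sum_mset (image_mset (huber \<epsilon>) (singular_values X))"

lemma smoothed_nuclear_norm_eq:
  "left_singular_decomp X U d \<Longrightarrow> smoothed_nuclear_norm \<epsilon> X = (\<Sum>i\<in>UNIV. huber \<epsilon> (d i))"
  by (simp add: smoothed_nuclear_norm_def singular_values_eq sum_unfold_sum_mset multiset.map_comp comp_def)

lemma nuclear_norm_le_smoothed: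
  assumes "0 < \<epsilon>" shows "nuclear_norm X \<le> smoothed_nuclear_norm \<epsilon> X"
proof -
  obtain U d where X: "left_singular_decomp X U d" by (rule left_singular_decomp_exists)
  show ?thesis
    unfolding nuclear_norm_eq[OF X] smoothed_nuclear_norm_eq[OF X] using assms by (intro sum_mono huber_ge)
qed

lemma smoothed_nuclear_norm_le:
  fixes X :: "complex^'p^'n"
  assumes "0 < \<epsilon>" shows "smoothed_nuclear_norm \<epsilon> X \<le> nuclear_norm X + real CARD('n) * \<epsilon> / 2"
proof -
  obtain U d where X: "left_singular_decomp X U d" by (rule left_singular_decomp_exists)
  have "smoothed_nuclear_norm \<epsilon> X \<le> (\<Sum>i\<in>UNIV. d i + \<epsilon> / 2)"
    unfolding smoothed_nuclear_norm_eq[OF X]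
    using assms left_singular_decompD(2)[OF X] by (intro sum_mono huber_le_add)
  then show ?thesis by (simp add: nuclear_norm_eq[OF X] sum.distrib)
qed

lemma ct_unitary_diag: "ct (U ** diag_matrix w ** ct U) = U ** diag_matrix w ** ct U"
  by (simp add: ct_mult matrix_mul_assoc)

lemma norm_sq_unitary_rows: "unitary U \<Longrightarrow> (\<Sum>i\<in>UNIV. (norm ((U ** X) $ i))\<^sup>2) = (norm X)\<^sup>2"
  unfolding norm_sq_rows[of "U ** X", symmetric] by (simp add: norm_mult_unitary_left)

lemma unitary_diag_coercive:
  assumes "unitary U" "\<And>i. c \<le> w i"
  shows "c * (norm X)\<^sup>2 \<le> X \<bullet> ((U ** diag_matrix w ** ct U) ** X)"
proof -
  have "c * (norm X)\<^sup>2 = (\<Sum>i\<in>UNIV. c * (norm ((ct U ** X) $ i))\<^sup>2)"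
    by (simp only: sum_distrib_left[symmetric] norm_sq_unitary_rows[OF unitary_ct[OF assms(1)]])
  also have "\<dots> \<le> (\<Sum>i\<in>UNIV. w i * (norm ((ct U ** X) $ i))\<^sup>2)"
    using assms(2) by (intro sum_mono mult_right_mono) auto
  also have "\<dots> = X \<bullet> ((U ** diag_matrix w ** ct U) ** X)"
    by (simp add: inner_unitary_diag[OF assms(1)] power2_norm_eq_inner)
  finally show ?thesis .
qed

lemma unitary_diag_norm_le:
  assumes U: "unitary U" and w: "\<And>i. 0 \<le> w i" "\<And>i. w i \<le> c"
  shows "norm ((U ** diag_matrix w ** ct U) ** X) \<le> c * norm X"
proof -
  define Y where "Y = (U ** diag_matrix w ** ct U) ** X"
  have U': "unitary (ct U)" using U by (rule unitary_ct)
  have "Y = U ** (diag_matrix w ** (ct U ** X))" by (simp only: Y_def matrix_mul_assoc)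
  then have "ct U ** Y = diag_matrix w ** (ct U ** X)" by (simp only: unitary_cancel[OF U])
  then have row: "norm ((ct U ** Y) $ i) \<le> c * norm ((ct U ** X) $ i)" for i
    using w by (simp add: diag_mult_row mult_right_mono)
  have "0 \<le> c" using w[of undefined] by linarith
  have "(norm Y)\<^sup>2 = (\<Sum>i\<in>UNIV. (norm ((ct U ** Y) $ i))\<^sup>2)"
    by (rule norm_sq_unitary_rows[OF U', symmetric])
  also have "\<dots> \<le> (\<Sum>i\<in>UNIV. (c * norm ((ct U ** X) $ i))\<^sup>2)"
    using row by (intro sum_mono power_mono) auto
  also have "\<dots> = (c * norm X)\<^sup>2"
    by (simp only: power_mult_distrib sum_distrib_left[symmetric] norm_sq_unitary_rows[OF U'])
  finally have "norm Y \<le> c * norm X" using \<open>0 \<le> c\<close> by (intro power2_le_imp_le[of "norm Y"]) auto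
  then show ?thesis by (simp only: Y_def)
qed

text \<open>The right side is the trace of the inverse of \<open>W\<close>. Half of
  \<open>Y \<bullet> (W ** Y)\<close> plus this trace is a quadratic majorant of the smoothed
  functional: it touches at \<open>X\<close> for \<open>\<epsilon>\<close> and stays above at every
  \<open>Y\<close>, also for smaller \<open>\<epsilon>'\<close>.\<close>

lemma irls_weight_majorizes:
  fixes X Y :: "complex^'p^'n"
  assumes \<epsilon>: "0 < \<epsilon>'" "\<epsilon>' \<le> \<epsilon>" and W: "W = irls_weight X \<epsilon>"
  shows "2 * smoothed_nuclear_norm \<epsilon>' Y - Y \<bullet> (W ** Y) \<le> 2 * smoothed_nuclear_norm \<epsilon> X - X \<bullet> (W ** X)"
proof -
  obtain U d where X: "left_singular_decomp X U d" by (rule left_singular_decomp_exists)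
  obtain V e where Y: "left_singular_decomp Y V e" by (rule left_singular_decomp_exists)
  define m where "m i = max (d i) \<epsilon>" for i
  have m: "\<epsilon> \<le> m i" "0 < m i" for i using \<epsilon> by (auto simp: m_def)
  have W: "W = U ** diag_matrix (\<lambda>i. inverse (m i)) ** ct U"
    unfolding W irls_weight_eq[OF X] m_def ..
  have U: "unitary U" using X by (rule left_singular_decompD)
  \<comment> \<open>The squared moduli of the entries of \<open>T\<close> form a doubly stochastic
    matrix. Spreading both sides over it gives double sums that \<open>huber_le_quadratic\<close>
    compares term by term.\<close>
  define T where "T = ct U ** V"
  have T: "unitary T"
    unfolding T_def using U left_singular_decompD(1)[OF Y] by (intro unitary_mult unitary_ct)
  have eq: "X \<bullet> (W ** X) = (\<Sum>i\<in>UNIV. inverse (m i) * (d i)\<^sup>2)"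
    by (simp add: W inner_unitary_diag[OF U] row_norm_decomp[OF X] flip: power2_norm_eq_inner)
  have "2 * smoothed_nuclear_norm \<epsilon> X - X \<bullet> (W ** X) = (\<Sum>i\<in>UNIV. m i)"
  proof -
    have "2 * huber \<epsilon> (d i) - inverse (m i) * (d i)\<^sup>2 = m i" for i
    proof -
      have 1: "inverse (m i) * (d i)\<^sup>2 = (d i)\<^sup>2 / m i" by (simp only: divide_inverse mult.commute)
      have 2: "2 * ((a + b) / 2) - a = b" for a b :: real by argo
      show ?thesis unfolding huber_def m_def[symmetric] 1 by (rule 2)
    qed
    then have "(\<Sum>i\<in>UNIV. 2 * huber \<epsilon> (d i)) - (\<Sum>i\<in>UNIV. inverse (m i) * (d i)\<^sup>2) = (\<Sum>i\<in>UNIV. m i)"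
      by (simp only: sum_subtractf[symmetric])
    then show ?thesis by (simp only: eq smoothed_nuclear_norm_eq[OF X] sum_distrib_left)
  qed
  also have "\<dots> = (\<Sum>i\<in>UNIV. m i * (\<Sum>j\<in>UNIV. (norm (T $ i $ j))\<^sup>2))"
    by (simp add: unitary_row_sum[OF T])
  also have "\<dots> = (\<Sum>i\<in>UNIV. \<Sum>j\<in>UNIV. (norm (T $ i $ j))\<^sup>2 * m i)"
    by (simp only: sum_distrib_left mult.commute)
  finally have 1: "2 * smoothed_nuclear_norm \<epsilon> X - X \<bullet> (W ** X) =
      (\<Sum>i\<in>UNIV. \<Sum>j\<in>UNIV. (norm (T $ i $ j))\<^sup>2 * m i)" .
  have "Y \<bullet> (W ** Y) = (\<Sum>i\<in>UNIV. inverse (m i) * (norm ((ct U ** Y) $ i))\<^sup>2)"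
    by (simp only: W inner_unitary_diag[OF U] power2_norm_eq_inner)
  then have 2: "Y \<bullet> (W ** Y) = (\<Sum>i\<in>UNIV. \<Sum>j\<in>UNIV. (norm (T $ i $ j))\<^sup>2 * ((e j)\<^sup>2 / m i))"
    by (simp only: row_norm_mult[OF Y] T_def sum_distrib_left divide_inverse mult_ac)
  have "2 * smoothed_nuclear_norm \<epsilon>' Y = (\<Sum>j\<in>UNIV. (\<Sum>i\<in>UNIV. (norm (T $ i $ j))\<^sup>2) * (2 * huber \<epsilon>' (e j)))"
    by (simp only: smoothed_nuclear_norm_eq[OF Y] unitary_col_sum[OF T] sum_distrib_left mult_1)
  also have "\<dots> = (\<Sum>j\<in>UNIV. \<Sum>i\<in>UNIV. (norm (T $ i $ j))\<^sup>2 * (2 * huber \<epsilon>' (e j)))"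
    by (simp only: sum_distrib_right)
  also have "\<dots> = (\<Sum>i\<in>UNIV. \<Sum>j\<in>UNIV. (norm (T $ i $ j))\<^sup>2 * (2 * huber \<epsilon>' (e j)))"
    by (rule sum.swap)
  also have "\<dots> \<le> (\<Sum>i\<in>UNIV. \<Sum>j\<in>UNIV. (norm (T $ i $ j))\<^sup>2 * ((e j)\<^sup>2 / m i + m i))"
  proof (intro sum_mono mult_left_mono)
    fix i j
    have "huber \<epsilon>' (e j) \<le> ((e j)\<^sup>2 / m i + m i) / 2"
      using \<epsilon> m(1)[of i] left_singular_decompD(2)[OF Y] by (intro huber_le_quadratic) auto
    then show "2 * huber \<epsilon>' (e j) \<le> (e j)\<^sup>2 / m i + m i" by simp
  qed auto
  finally show ?thesis unfolding 1 2 by (simp only: distrib_left sum.distrib le_diff_eq diff_le_eq add.commute)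
qed

text \<open>\<open>G = W ** X\<close> has singular values \<open>d i / max (d i) \<epsilon>\<close>,
  so it is a contraction, and Fenchel-Young applies row by row in the basis of left singular vectors
  of \<open>Y\<close>. The conjugate terms add up to \<open>c\<close>, which depends on
  \<open>G\<close> only through its Frobenius norm and is therefore the same in the bases for
  \<open>X\<close> and for \<open>Y\<close>.\<close>

lemma smoothed_nuclear_norm_subgradient:
  fixes X Y :: "complex^'p^'n"
  assumes \<epsilon>: "0 < \<epsilon>" and W: "W = irls_weight X \<epsilon>"
  shows "smoothed_nuclear_norm \<epsilon> X + (W ** X) \<bullet> (Y - X) \<le> smoothed_nuclear_norm \<epsilon> Y"
proof -
  obtain U d where X: "left_singular_decomp X U d" by (rule left_singular_decomp_exists)
  obtain V e where Y: "left_singular_decomp Y V e" by (rule left_singular_decomp_exists)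
  note D = left_singular_decompD[OF X]
  define w where "w i = inverse (max (d i) \<epsilon>)" for i
  have w: "0 \<le> w i" for i using \<epsilon> by (simp add: w_def le_max_iff_disj)
  have W: "W = U ** diag_matrix w ** ct U" unfolding W irls_weight_eq[OF X] w_def ..
  define G where "G = W ** X"
  have "G ** ct G = W ** (X ** ct X) ** W"
    by (simp add: G_def ct_mult W ct_unitary_diag matrix_mul_assoc)
  also have "\<dots> = U ** diag_matrix (\<lambda>i. (w i * (d i)\<^sup>2) * w i) ** ct U"
    unfolding W D(3) unitary_diag_mult[OF D(1)] ..
  finally have G: "left_singular_decomp G U (\<lambda>i. w i * d i)"
    using D w by (simp add: left_singular_decomp_def diag_mult_diag power2_eq_square mult_ac)
  have contr: "contraction G"
  proof (rule contraction_if_singular_values_le_1[OF G])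
    show "w i * d i \<le> 1" for i
    proof -
      have "0 < max (d i) \<epsilon>" using \<epsilon> by simp
      then show ?thesis unfolding w_def by (simp add: inverse_eq_divide)
    qed
  qed
  have GX: "G \<bullet> X = (\<Sum>i\<in>UNIV. w i * (d i)\<^sup>2)"
    by (simp add: G_def W inner_commute[of _ X] inner_unitary_diag[OF D(1)] row_norm_decomp[OF X]
        flip: power2_norm_eq_inner)
  define c where "c = \<epsilon> / 2 * (real CARD('n) - (norm G)\<^sup>2)"
  have "smoothed_nuclear_norm \<epsilon> X = (\<Sum>i\<in>UNIV. w i * (d i)\<^sup>2 + \<epsilon> / 2 * (1 - (w i * d i)\<^sup>2))"
    unfolding smoothed_nuclear_norm_eq[OF X] w_def huber_fenchel_eq[OF \<epsilon>] ..
  also have "\<dots> = G \<bullet> X + c"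
    unfolding sum.distrib c_def sum_distrib_left[symmetric] sum_subtractf GX norm_sq_decomp[OF G] by simp
  finally have X_eq: "smoothed_nuclear_norm \<epsilon> X = G \<bullet> X + c" .
  have V: "unitary (ct V)" using Y by (simp add: left_singular_decompD unitary_ct)
  define g where "g i = norm ((ct V ** G) $ i)" for i
  have "G \<bullet> Y = (\<Sum>i\<in>UNIV. (ct V ** G) $ i \<bullet> (ct V ** Y) $ i)"
    using inner_unitary[OF V, of G Y] by (simp add: inner_vec_def)
  also have "\<dots> \<le> (\<Sum>i\<in>UNIV. g i * e i)"
    unfolding g_def row_norm_decomp[OF Y, symmetric] by (intro sum_mono norm_cauchy_schwarz)
  also have "\<dots> \<le> (\<Sum>i\<in>UNIV. huber \<epsilon> (e i) - \<epsilon> / 2 * (1 - (g i)\<^sup>2))"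
    using contr V by (intro sum_mono huber_fenchel[OF \<epsilon>]) (auto simp: g_def contraction_def)
  also have "\<dots> = smoothed_nuclear_norm \<epsilon> Y - c"
  proof -
    have "(\<Sum>i\<in>UNIV. (g i)\<^sup>2) = (norm G)\<^sup>2"
      by (simp only: g_def norm_sq_unitary_rows[OF V])
    then show ?thesis
      unfolding smoothed_nuclear_norm_eq[OF Y] sum_subtractf sum_distrib_left[symmetric] c_def by simp
  qed
  finally show ?thesis unfolding X_eq by (simp add: inner_diff_right flip: G_def)
qed

text \<open>Existence comes from coercivity, as \<open>W\<close> is positive definite; orthogonality
  to the kernel of \<open>S\<close> is the vanishing first variation.\<close>

lemma weighted_minimizer:
  fixes S :: "complex^'p^'n \<Rightarrow> complex^'m"
  assumes S: "linear S" and U: "unitary U" and w: "\<And>i. 0 < w i"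
    and W: "W = U ** diag_matrix w ** ct U" and X0: "S X0 = M"
  shows "S (weighted_minimizer S M W) = M"
    and "S H = 0 \<Longrightarrow> (W ** weighted_minimizer S M W) \<bullet> H = 0"
proof -
  define f where "f X = X \<bullet> (W ** X)" for X :: "complex^'p^'n"
  have ctW: "ct W = W" by (simp add: W ct_unitary_diag)
  have f: "(norm (matrix_sqrt W ** X))\<^sup>2 = f X" for X :: "complex^'p^'n"
  proof -
    define R where "R = U ** diag_matrix (\<lambda>i. sqrt (w i)) ** ct U"
    have "matrix_sqrt W = R" unfolding W R_def using U w by (intro matrix_sqrt_eq) (auto intro: less_imp_le)
    moreover have "ct R ** R = W"
      using w by (simp add: R_def W ct_unitary_diag unitary_diag_mult[OF U] less_imp_le)
    ultimately show ?thesis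
      by (simp add: f_def power2_norm_eq_inner inner_mult_left matrix_mul_assoc)
  qed
  define c where "c = Min (range w)"
  have c: "0 < c" "\<And>i. c \<le> w i" using w by (auto simp: c_def)
  have coer: "c * (norm X)\<^sup>2 \<le> f X" for X unfolding f_def W by (rule unitary_diag_coercive[OF U c(2)])
  have "linear (\<lambda>X :: complex^'p^'n. W ** X)"
    by (rule linearI) (simp_all add: matrix_add_ldistrib matrix_mult_scaleR)
  then have "continuous_on UNIV (\<lambda>X :: complex^'p^'n. W ** X)"
    by (simp add: linear_continuous_on linear_conv_bounded_linear)
  then have cont: "continuous_on UNIV f" unfolding f_def by (intro continuous_intros)
  \<comment> \<open>A compact set containing every feasible point that is no worse than
    \<open>X0\<close>, so a minimum over it is global.\<close>
  define T where "T = {X. S X = M} \<inter> cball 0 (sqrt (f X0 / c))"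
  have "closed {X. S X = M}"
    using S by (intro closed_Collect_eq continuous_on_const linear_continuous_on) (simp add: linear_conv_bounded_linear)
  then have "compact T" unfolding T_def by (intro closed_Int_compact compact_cball)
  moreover have inT: "X \<in> T" if "S X = M" "f X \<le> f X0" for X
  proof -
    have "(norm X)\<^sup>2 \<le> f X0 / c" using coer[of X] that c(1) by (simp add: pos_le_divide_eq mult.commute)
    then show ?thesis using that by (simp add: T_def real_le_rsqrt)
  qed
  ultimately obtain Y where Y: "Y \<in> T" "\<And>X. X \<in> T \<Longrightarrow> f Y \<le> f X"
    using continuous_attains_inf[of T f] continuous_on_subset[OF cont] X0 by blast
  have "is_arg_min (\<lambda>X. (norm (matrix_sqrt W ** X))\<^sup>2) (\<lambda>X. S X = M) Y"
    unfolding is_arg_min_linorder f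
  proof (intro conjI allI impI)
    show "S Y = M" using Y(1) by (simp add: T_def)
    fix X assume "S X = M"
    then show "f Y \<le> f X" using inT[of X] Y(2)[of X] Y(2)[OF inT[OF X0]] by linarith
  qed
  \<comment> \<open>\<open>arg_min\<close> is a choice among minimizers, so the existence of one
    makes the chosen point a minimizer.\<close>
  then have "is_arg_min (\<lambda>X. (norm (matrix_sqrt W ** X))\<^sup>2) (\<lambda>X. S X = M) (weighted_minimizer S M W)"
    unfolding weighted_minimizer_def arg_min_def by (rule someI)
  then have Z: "S (weighted_minimizer S M W) = M" "\<And>X. S X = M \<Longrightarrow> f (weighted_minimizer S M W) \<le> f X"
    unfolding is_arg_min_linorder f by auto
  show "S (weighted_minimizer S M W) = M" by (rule Z(1))
  define Z where "Z = weighted_minimizer S M W"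
  assume H: "S H = 0"
  define b where "b = (W ** Z) \<bullet> H"
  have sym: "Z \<bullet> (W ** H) = b"
    unfolding b_def inner_mult_left ctW ..
  have "0 \<le> t\<^sup>2 * f H + 2 * t * b" for t
  proof -
    have "f Z \<le> f (Z + t *\<^sub>R H)"
      unfolding Z_def using H Z(1) by (intro Z(2)) (simp add: linear_add[OF S] linear_scale[OF S])
    also have "f (Z + t *\<^sub>R H) = f Z + t\<^sup>2 * f H + 2 * t * b"
      using sym by (simp add: f_def matrix_add_ldistrib matrix_mult_scaleR inner_add_left inner_add_right
          b_def inner_commute power2_eq_square algebra_simps)
    finally show ?thesis by simp
  qed
  moreover have "0 \<le> f H" using coer[of H] c(1) by (meson order_trans mult_nonneg_nonneg less_imp_le zero_le_power2)
  ultimately have "b = 0"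
  proof -
    assume a: "\<And>t. 0 \<le> t\<^sup>2 * f H + 2 * t * b" and h: "0 \<le> f H"
    \<comment> \<open>A step against the slope \<open>b\<close>; the summand 1 keeps the denominator
      positive when \<open>f H\<close> is 0.\<close>
    have "0 \<le> (- b / (f H + 1))\<^sup>2 * f H + 2 * (- b / (f H + 1)) * b" by (rule a)
    also have "\<dots> = - (b\<^sup>2 * (f H + 2)) / (f H + 1)\<^sup>2"
      using h by (simp add: divide_simps) algebra
    finally have "b\<^sup>2 * (f H + 2) \<le> 0" using h zero_le_power2[of "f H + 1"]
      by (auto simp: divide_le_0_iff)
    then show ?thesis using h by (simp add: mult_le_0_iff)
  qed
  then show "(W ** weighted_minimizer S M W) \<bullet> H = 0" by (simp add: b_def Z_def)
qed

text \<open>An Eckart--Young type bound, obtained by projecting onto the orthogonal complement of the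
  column space of \<open>X\<close>.\<close>

lemma rank_approximation_error:
  fixes X Y :: "complex^'p^'n"
  assumes Y: "left_singular_decomp Y U d" and \<sigma>: "0 \<le> \<sigma>" "\<And>j. j \<in> B \<Longrightarrow> \<sigma> \<le> d j"
  shows "(real (card B) - real (rank X)) * \<sigma>\<^sup>2 \<le> (norm (Y - X))\<^sup>2"
proof -
  obtain G :: "complex^'p^'n" where G: "G ** ct G ** G = G" "G ** ct G ** X = X" "(norm G)\<^sup>2 \<le> real (rank X)"
    by (rule polar_factor[of X]) blast
  note D = left_singular_decompD[OF Y]
  define E where "E = mat 1 - G ** ct G"
  have ctE: "ct E = E" by (simp add: E_def ct_diff ct_mult)
  have EE: "E ** E = E" using G(1) by (simp add: E_def matrix_distribs matrix_mul_assoc)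
  have EX: "E ** X = 0" using G(2) by (simp add: E_def matrix_distribs)
  define Z where "Z = ct U ** G"
  have "ct (E ** U) ** ct (ct (E ** U)) = ct U ** (E ** E) ** U"
    by (simp add: ct_mult ctE matrix_mul_assoc)
  also have "\<dots> = mat 1 - Z ** ct Z"
  proof -
    have "ct U ** (E ** E) ** U = ct U ** U - ct U ** (G ** ct G) ** U"
      unfolding EE by (simp only: E_def matrix_distribs matrix_mul_rid)
    then show ?thesis using D(1) by (simp add: Z_def ct_mult matrix_mul_assoc unitary_def)
  qed
  finally have gram: "ct (E ** U) ** ct (ct (E ** U)) = mat 1 - Z ** ct Z" .
  have col: "(\<Sum>i\<in>UNIV. (norm ((E ** U) $ i $ j))\<^sup>2) = 1 - (norm (Z $ j))\<^sup>2" for j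
  proof -
    have "of_real ((norm (ct (E ** U) $ j))\<^sup>2) = (mat 1 - Z ** ct Z) $ j $ j"
      unfolding gram[symmetric] mult_ct_diag ..
    also have "\<dots> = of_real (1 - (norm (Z $ j))\<^sup>2)"
      unfolding vector_minus_component mult_ct_diag by (simp add: mat_def)
    finally have "(norm (ct (E ** U) $ j))\<^sup>2 = 1 - (norm (Z $ j))\<^sup>2" using of_real_eq_iff by blast
    then show ?thesis by (simp add: norm_sq_row)
  qed
  \<comment> \<open>Projecting by \<open>E\<close> costs the unit columns of \<open>U\<close> in
    total \<open>(norm G)\<^sup>2\<close>, at most the rank of \<open>X\<close>, of their squared
    norms; at least \<open>card B - rank X\<close> is left on \<open>B\<close>.\<close>
  have "(\<Sum>j\<in>B. (norm (Z $ j))\<^sup>2) \<le> (\<Sum>j\<in>UNIV. (norm (Z $ j))\<^sup>2)" by (intro sum_mono2) auto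
  also have "\<dots> = (norm G)\<^sup>2"
    by (simp only: Z_def norm_sq_unitary_rows[OF unitary_ct[OF D(1)]])
  also have "\<dots> \<le> real (rank X)" by (rule G(3))
  finally have "real (card B) - real (rank X) \<le> (\<Sum>j\<in>B. 1 - (norm (Z $ j))\<^sup>2)"
    by (simp add: sum_subtractf)
  then have "(real (card B) - real (rank X)) * \<sigma>\<^sup>2 \<le> (\<Sum>j\<in>B. 1 - (norm (Z $ j))\<^sup>2) * \<sigma>\<^sup>2"
    by (intro mult_right_mono) auto
  also have "\<dots> = (\<Sum>j\<in>B. (\<Sum>i\<in>UNIV. (norm ((E ** U) $ i $ j))\<^sup>2) * \<sigma>\<^sup>2)"
    by (simp add: col sum_distrib_right)
  also have "\<dots> \<le> (\<Sum>j\<in>B. (\<Sum>i\<in>UNIV. (norm ((E ** U) $ i $ j))\<^sup>2) * (d j)\<^sup>2)"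
    using \<sigma> by (intro sum_mono mult_left_mono power_mono sum_nonneg) auto
  also have "\<dots> \<le> (\<Sum>j\<in>UNIV. (\<Sum>i\<in>UNIV. (norm ((E ** U) $ i $ j))\<^sup>2) * (d j)\<^sup>2)"
    by (intro sum_mono2) (auto intro!: mult_nonneg_nonneg sum_nonneg)
  also have "\<dots> = (\<Sum>j\<in>UNIV. \<Sum>i\<in>UNIV. (norm ((E ** U) $ i $ j))\<^sup>2 * (d j)\<^sup>2)"
    by (simp only: sum_distrib_right)
  also have "\<dots> = (\<Sum>i\<in>UNIV. \<Sum>j\<in>UNIV. (norm ((E ** U) $ i $ j))\<^sup>2 * (d j)\<^sup>2)"
    by (rule sum.swap)
  also have "\<dots> = (norm (E ** Y))\<^sup>2"
    unfolding norm_sq_rows[of "E ** Y"] row_norm_mult[OF Y] ..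
  also have "E ** Y = E ** (Y - X)" by (simp add: matrix_diff_ldistrib EX)
  also have "(norm (E ** (Y - X)))\<^sup>2 = (Y - X) \<bullet> (E ** (Y - X))"
    by (simp add: power2_norm_eq_inner inner_mult_left ctE matrix_mul_assoc EE)
  also have "\<dots> = (norm (Y - X))\<^sup>2 - (norm (ct G ** (Y - X)))\<^sup>2"
  proof -
    have "(norm (ct G ** (Y - X)))\<^sup>2 = (Y - X) \<bullet> (G ** ct G ** (Y - X))"
      by (simp add: power2_norm_eq_inner inner_mult_left matrix_mul_assoc)
    then show ?thesis
      by (simp only: E_def matrix_diff_rdistrib matrix_mul_lid inner_diff_right power2_norm_eq_inner[of "Y - X"])
  qed
  also have "\<dots> \<le> (norm (Y - X))\<^sup>2" by simp
  finally show ?thesis .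
qed

section \<open>Convergence of the algorithm\<close>

lemma rank_le_CARD: "rank A \<le> CARD('n)" for A :: "complex^'p^'n"
  using rank_diag_mult_le[of "mat 1 :: complex^'n^'n" "UNIV :: 'n set" A] by (simp add: diag_1)

locale irls_recovery =
  fixes S :: "complex^'p^'n \<Rightarrow> complex^'m" and M :: "complex^'m"
    and X :: "complex^'p^'n" and K k :: nat and \<eta> :: real
  assumes K: "2 < K" "4 * K \<le> CARD('n)"
    and S: "linear S" and ric: "ric S (3 * K) < 1"
    and \<eta>: "\<eta> = sqrt 2 * ric S (4 * K) / (1 - ric S (3 * K))" "\<eta> < 1 - 2 / (real K - 2)"
    and X: "rank X \<le> k" "S X = M" and k: "real k < real K - 2 * \<eta> / (1 - \<eta>)"
begin

abbreviation \<sigma> :: "complex^'p^'n \<Rightarrow> real" where "\<sigma> \<equiv> singular_value (K + 1)"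

lemma K_less: "K < CARD('n)" and n_pos: "0 < real CARD('n)"
  using K by auto

lemma \<eta>_nonneg: "0 \<le> \<eta>"
  unfolding \<eta>(1) using ric ric_nonneg[OF S] by simp

lemma \<eta>_less: "\<eta> < 1"
proof -
  have "0 \<le> 2 / (real K - 2)" using K(1) by simp
  then show ?thesis using \<eta>(2) by linarith
qed

lemma k_less: "k < K"
proof -
  have "0 \<le> 2 * \<eta> / (1 - \<eta>)" using \<eta>_nonneg \<eta>_less by simp
  then have "real k < real K" using k by linarith
  then show ?thesis by simp
qed

section \<open>Consequences of the restricted isometry property for feasible matrices\<close>

definition \<kappa> :: real where "\<kappa> = (1 + \<eta>) / (sqrt (real K) * (1 - \<eta>))"

lemma \<kappa>_nonneg: "0 \<le> \<kappa>"
  unfolding \<kappa>_def using \<eta>_nonneg \<eta>_less by simp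

lemma stability: "S Z = M \<Longrightarrow> norm (Z - X) \<le> \<kappa> * (nuclear_norm Z - nuclear_norm X)"
  unfolding \<kappa>_def using K(1) X k_less \<eta>_less
  by (intro rip_implies_nuclear_norm_stability[OF S _ _ _ ric \<eta>(1)]) auto

text \<open>With \<open>a = (1 + \<eta>) / (1 - \<eta>)\<close>, the bound on \<open>\<eta>\<close>
  gives \<open>a \<le> K\<close>, so the square of \<open>\<kappa>\<close>, which is
  \<open>a * (a / K)\<close>, is at most \<open>a\<close>. As
  \<open>a = 1 + 2 * \<eta> / (1 - \<eta>)\<close>, the bound on \<open>k\<close> is exactly
  \<open>a < K + 1 - k\<close>.\<close>

lemma \<kappa>_bound: "\<kappa>\<^sup>2 < real K + 1 - real k"
proof -
  have K2: "0 < real K - 2" using K(1) by simp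
  have pos: "0 < 1 - \<eta>" using \<eta>_less by simp
  have "2 / (real K - 2) < 1 - \<eta>" using \<eta>(2) by linarith
  then have "2 < (1 - \<eta>) * (real K - 2)" unfolding pos_divide_less_eq[OF K2] .
  also have "\<dots> \<le> (1 - \<eta>) * real K" using pos by (intro mult_left_mono) auto
  finally have "1 + \<eta> \<le> real K * (1 - \<eta>)" using \<eta>_less by (simp add: mult.commute)
  define a where "a = (1 + \<eta>) / (1 - \<eta>)"
  have "0 \<le> a" using \<eta>_nonneg pos by (simp add: a_def)
  have "a \<le> real K" unfolding a_def pos_divide_le_eq[OF pos] by fact
  have "\<kappa> = a / sqrt (real K)" by (simp add: \<kappa>_def a_def mult.commute)
  then have "\<kappa>\<^sup>2 = a * (a / real K)" by (simp add: power_divide) (simp add: power2_eq_square)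
  also have "\<dots> \<le> a * 1"
    using \<open>0 \<le> a\<close> \<open>a \<le> real K\<close> K(1) by (intro mult_left_mono) (auto simp: divide_le_eq_1)
  also have "\<dots> = 1 + 2 * \<eta> / (1 - \<eta>)" unfolding a_def using pos by (simp add: divide_simps)
  also have "\<dots> < real K + 1 - real k" using k by linarith
  finally show ?thesis .
qed

lemma \<sigma>_nonneg: "0 \<le> \<sigma> Z"
proof -
  obtain U d where Z: "left_singular_decomp Z U d" by (rule left_singular_decomp_exists)
  obtain B i where "\<sigma> Z = d i" using singular_value_split[OF Z K_less] by metis
  then show ?thesis using left_singular_decompD(2)[OF Z] by simp
qed

lemma \<sigma>_lower_bound: "(real K + 1 - real k) * (\<sigma> Z)\<^sup>2 \<le> (norm (Z - X))\<^sup>2"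
proof -
  obtain U d where Z: "left_singular_decomp Z U d" by (rule left_singular_decomp_exists)
  obtain B i where B: "card B = K" "i \<notin> B" "\<sigma> Z = d i" "\<And>j. j \<in> B \<Longrightarrow> d i \<le> d j"
    using singular_value_split[OF Z K_less] by metis
  \<comment> \<open>The index of the value \<sigma> itself is counted too, which gives
    \<open>K + 1\<close> instead of \<open>K\<close>.\<close>
  have "card (insert i B) = K + 1" using B by simp
  then have "(real K + 1 - real (rank X)) * (\<sigma> Z)\<^sup>2 \<le> (norm (Z - X))\<^sup>2"
    using rank_approximation_error[OF Z \<sigma>_nonneg, of "insert i B" Z X] B by (auto simp: add.commute)
  moreover have "(real K + 1 - real k) * (\<sigma> Z)\<^sup>2 \<le> (real K + 1 - real (rank X)) * (\<sigma> Z)\<^sup>2"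
    using X(1) by (intro mult_right_mono) auto
  ultimately show ?thesis by linarith
qed

text \<open>The truncation \<open>T\<close> of \<open>Z\<close> to its top \<open>K\<close> singular
  values differs from \<open>Z\<close> by a multiple of \<open>\<sigma> Z\<close>.
  \<open>T - X\<close> has rank below \<open>3 * K\<close> and image \<open>- S (Z - T)\<close>, so
  the lower isometry bound transfers this estimate to it.\<close>

lemma \<sigma>_controls_error: "\<exists>C\<ge>0. \<forall>Z. S Z = M \<longrightarrow> norm (Z - X) \<le> C * \<sigma> Z"
proof -
  obtain c where c: "\<And>Y. norm (S Y) \<le> c * norm Y" "0 < c"
    using linear_bounded_pos[OF S] by blast
  define r where "r = sqrt (1 - ric S (3 * K))"
  have r: "0 < r" using ric by (simp add: r_def)
  have "norm (Z - X) \<le> ((1 + c / r) * sqrt (real CARD('n))) * \<sigma> Z" if Z: "S Z = M" for Z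
  proof -
    obtain U d where dec: "left_singular_decomp Z U d" by (rule left_singular_decomp_exists)
    obtain B i where B: "card B = K" "\<sigma> Z = d i" "\<And>j. j \<notin> B \<Longrightarrow> d j \<le> d i"
      using singular_value_split[OF dec K_less] by metis
    define T where "T = singular_block U B Z"
    have ZT: "Z = T + singular_block U (- B) Z"
      unfolding T_def using singular_block_Un[of B "- B" U Z]
        singular_block_UNIV[OF left_singular_decompD(1)[OF dec], of Z] by simp
    have tail: "norm (Z - T) \<le> sqrt (real CARD('n)) * \<sigma> Z"
    proof -
      have "Z - T = singular_block U (- B) Z" using ZT by (simp add: algebra_simps)
      then have "norm (Z - T) = sqrt (\<Sum>j\<in>- B. (d j)\<^sup>2)" by (simp add: singular_block_norm[OF dec])
      also have "\<dots> \<le> sqrt (real CARD('n)) * \<sigma> Z"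
        using B(2,3) left_singular_decompD(2)[OF dec] \<sigma>_nonneg[of Z]
        by (intro sum_power2_le_card_bound) (auto intro: card_mono)
      finally show ?thesis .
    qed
    have "rank (T - X) \<le> 3 * K"
      using rank_diff_le[of T X] rank_singular_block_le[of U B Z] B(1) X(1) k_less by (simp add: T_def)
    then have "r\<^sup>2 * (norm (T - X))\<^sup>2 \<le> (norm (S (T - X)))\<^sup>2"
      using ric_lower[OF S, of "T - X" "3 * K"] ric by (simp add: r_def)
    then have "(r * norm (T - X))\<^sup>2 \<le> (norm (S (T - X)))\<^sup>2" by (simp add: power_mult_distrib)
    then have "r * norm (T - X) \<le> norm (S (T - X))" by (rule power2_le_imp_le) simp
    also have "S (T - X) = - S (Z - T)" using Z X(2) by (simp add: linear_diff[OF S])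
    also have "norm (- S (Z - T)) \<le> c * norm (Z - T)" using c(1) by simp
    finally have "norm (T - X) * r \<le> c * norm (Z - T)" by (simp only: mult.commute)
    then have "norm (T - X) \<le> c * norm (Z - T) / r" unfolding pos_le_divide_eq[OF r] .
    then have "norm (Z - X) \<le> (1 + c / r) * norm (Z - T)"
      using norm_triangle_ineq[of "Z - T" "T - X"] by (simp add: distrib_right)
    also have "\<dots> \<le> (1 + c / r) * (sqrt (real CARD('n)) * \<sigma> Z)"
      using tail c(2) r by (intro mult_left_mono) auto
    finally show ?thesis by (simp add: mult.assoc)
  qed
  then show ?thesis using c(2) r by (intro exI[of _ "(1 + c / r) * sqrt (real CARD('n))"]) auto
qed

section \<open>The sequences of iterates, weights and smoothing parameters\<close>

definition x :: "nat \<Rightarrow> complex^'p^'n" where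
  "x l = irls_iterate S M K (1 / real CARD('n)) l"

definition w :: "nat \<Rightarrow> complex^'n^'n" where
  "w l = fst (snd (irls_state S M K (1 / real CARD('n)) l))"

definition e :: "nat \<Rightarrow> real" where
  "e l = snd (snd (irls_state S M K (1 / real CARD('n)) l))"

lemma irls_0: "w 0 = mat 1" "e 0 = 1"
  by (simp_all add: w_def e_def)

lemma irls_stopped: "e l = 0 \<Longrightarrow> x (Suc l) = x l \<and> e (Suc l) = 0"
  by (cases "irls_state S M K (1 / real CARD('n)) l") (simp add: x_def e_def irls_iterate_def)

lemma irls_Suc:
  assumes "e l \<noteq> 0"
  shows "x (Suc l) = weighted_minimizer S M (w l)"
    and "e (Suc l) = min (e l) (\<sigma> (x (Suc l)) / real CARD('n))"
    and "w (Suc l) = irls_weight (x (Suc l)) (e (Suc l))"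
  using assms by (cases "irls_state S M K (1 / real CARD('n)) l"; simp add: x_def w_def e_def irls_iterate_def Let_def)+

lemma e_nonneg: "0 \<le> e l"
proof (induction l)
  case (Suc l)
  then show ?case
    using irls_stopped[of l] irls_Suc(2)[of l] \<sigma>_nonneg[of "x (Suc l)"] n_pos by (cases "e l = 0") auto
qed (simp add: irls_0)

lemma e_Suc_le: "e (Suc l) \<le> e l"
  using irls_stopped[of l] irls_Suc(2)[of l] by (cases "e l = 0") auto

lemma e_le_1: "e l \<le> 1"
proof (induction l)
  case (Suc l)
  then show ?case using e_Suc_le[of l] by linarith
qed (simp add: irls_0)

lemma weight_form:
  assumes "0 < e l"
  obtains U d where "unitary U" "\<And>i. 0 < d i" "w l = U ** diag_matrix d ** ct U"
proof (cases l)
  case 0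
  then show ?thesis
    using that[of "mat 1" "\<lambda>_. 1"] by (simp add: irls_0 unitary_mat_1 diag_1)
next
  case (Suc l')
  then have "e l' \<noteq> 0" using assms e_Suc_le[of l'] by auto
  obtain U d where dec: "left_singular_decomp (x l) U d" by (rule left_singular_decomp_exists)
  have "w l = U ** diag_matrix (\<lambda>i. inverse (max (d i) (e l))) ** ct U"
    using irls_Suc(3)[OF \<open>e l' \<noteq> 0\<close>] Suc irls_weight_eq[OF dec] by simp
  moreover have "0 < inverse (max (d i) (e l))" for i
    using assms by (simp add: less_max_iff_disj)
  ultimately show ?thesis using left_singular_decompD(1)[OF dec] by (intro that)
qed

lemma minimizer:
  assumes "0 < e l"
  shows "S (x (Suc l)) = M" and "S H = 0 \<Longrightarrow> (w l ** x (Suc l)) \<bullet> H = 0"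
proof -
  obtain U d where U: "unitary U" "\<And>i. 0 < d i" "w l = U ** diag_matrix d ** ct U"
    using weight_form[OF assms] by blast
  have "x (Suc l) = weighted_minimizer S M (w l)" using assms by (intro irls_Suc(1)) simp
  then show "S (x (Suc l)) = M" and "S H = 0 \<Longrightarrow> (w l ** x (Suc l)) \<bullet> H = 0"
    using weighted_minimizer[OF S U X(2)] by simp_all
qed

lemma feasible: "S (x (Suc l)) = M"
proof (induction l)
  case 0
  show ?case by (rule minimizer) (simp add: irls_0)
next
  case (Suc l)
  show ?case
  proof (cases "e (Suc l) = 0")
    case True
    then show ?thesis using irls_stopped Suc by simp
  next
    case False
    then show ?thesis using e_nonneg[of "Suc l"] by (intro minimizer) simp
  qed
qed

lemma e_le_\<sigma>: "real CARD('n) * e (Suc l) \<le> \<sigma> (x (Suc l))"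
proof (induction l)
  case 0
  have "e (Suc 0) \<le> \<sigma> (x (Suc 0)) / real CARD('n)" using irls_Suc(2)[of 0] by (simp add: irls_0)
  then show ?case using n_pos by (simp add: pos_le_divide_eq mult.commute)
next
  case (Suc l)
  show ?case
  proof (cases "e (Suc l) = 0")
    case True
    then show ?thesis using irls_stopped[of "Suc l"] \<sigma>_nonneg by simp
  next
    case False
    then have "e (Suc (Suc l)) \<le> \<sigma> (x (Suc (Suc l))) / real CARD('n)" using irls_Suc(2) by simp
    then show ?thesis using n_pos by (simp add: pos_le_divide_eq mult.commute)
  qed
qed

text \<open>\<open>e\<close> changes only at steps where it is set to \<sigma> divided by the
  dimension; the induction keeps track of the last such step. The value 1 covers a run in which
  \<open>e\<close> has not dropped yet.\<close>

lemma e_attained: "e (Suc l) = 1 \<or> (\<exists>j\<le>l. e (Suc j) = e (Suc l) \<and> \<sigma> (x (Suc j)) = real CARD('n) * e (Suc l))"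
proof (induction l)
  case 0
  show ?case using irls_Suc(2)[of 0] n_pos by (auto simp: irls_0 min_def)
next
  case (Suc l)
  show ?case
  proof (cases "e (Suc (Suc l)) = e (Suc l)")
    case True
    then show ?thesis using Suc le_SucI by metis
  next
    case False
    then have "e (Suc l) \<noteq> 0" using irls_stopped by auto
    then have "e (Suc (Suc l)) = \<sigma> (x (Suc (Suc l))) / real CARD('n)"
      using irls_Suc(2)[of "Suc l"] False by (auto simp: min_def split: if_splits)
    then show ?thesis using n_pos by (intro disjI2 exI[of _ "Suc l"]) simp
  qed
qed

text \<open>Shifted by one, since \<open>x 0\<close> is a placeholder and need not be
  feasible.\<close>

definition J :: "nat \<Rightarrow> real" where
  "J l = smoothed_nuclear_norm (e (Suc l)) (x (Suc l))"

lemma stopped_forever: "e l = 0 \<Longrightarrow> x (l + j) = x l \<and> e (l + j) = 0"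
  by (induction j) (use irls_stopped in auto)

text \<open>When \<open>e\<close> drops to 0, \<sigma> of the iterate is 0, so
  \<open>\<sigma>_controls_error\<close> makes the iterate equal to \<open>X\<close>; afterwards the
  state is frozen.\<close>

lemma finite_termination:
  assumes "e l = 0" shows "x \<longlonglongrightarrow> X"
proof -
  obtain l' where l': "l = Suc l'" using assms irls_0(2) by (cases l) auto
  obtain j where j: "e (Suc j) = 0" "\<sigma> (x (Suc j)) = 0"
    using e_attained[of l'] assms l' by auto
  obtain C where "norm (x (Suc j) - X) \<le> C * \<sigma> (x (Suc j))"
    using \<sigma>_controls_error feasible by blast
  then have "x (Suc j) = X" using j(2) by simp
  then have "x (i + Suc j) = X" for i using stopped_forever[OF j(1), of i] by (simp add: add.commute)
  then have "(\<lambda>i. x (i + Suc j)) \<longlonglongrightarrow> X" by simp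
  then show ?thesis by (rule LIMSEQ_offset)
qed

section \<open>Runs that never stop\<close>

context
  assumes e_pos: "\<And>l. 0 < e l"
begin

lemma w_Suc: "w (Suc l) = irls_weight (x (Suc l)) (e (Suc l))"
  using e_pos[of l] by (intro irls_Suc) simp

lemma nuclear_norm_le_J: "nuclear_norm (x (Suc l)) \<le> J l"
  unfolding J_def by (rule nuclear_norm_le_smoothed[OF e_pos])

lemma J_nonneg: "0 \<le> J l"
  using nuclear_norm_le_J[of l] nuclear_norm_nonneg[of "x (Suc l)"] by linarith

text \<open>Majorization combined with Pythagoras in the inner product given by \<open>W\<close>:
  the new iterate \<open>Y\<close> is orthogonal to \<open>Z - Y\<close>, which lies in the kernel
  of \<open>S\<close>.\<close>

lemma J_decrease:
  "2 * J (Suc l) + (x (Suc l) - x (Suc (Suc l))) \<bullet> (w (Suc l) ** (x (Suc l) - x (Suc (Suc l)))) \<le> 2 * J l"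
proof -
  define W where "W = w (Suc l)"
  define Y where "Y = x (Suc (Suc l))"
  define Z where "Z = x (Suc l)"
  have ctW: "ct W = W"
    using weight_form[OF e_pos[of "Suc l"]] ct_unitary_diag unfolding W_def by metis
  have "2 * J (Suc l) - Y \<bullet> (W ** Y) \<le> 2 * J l - Z \<bullet> (W ** Z)"
    unfolding J_def Y_def Z_def by (rule irls_weight_majorizes[OF e_pos e_Suc_le]) (simp add: W_def w_Suc)
  moreover have "(W ** Y) \<bullet> (Z - Y) = 0"
    unfolding W_def Y_def Z_def using feasible
    by (intro minimizer(2)[OF e_pos]) (simp add: linear_diff[OF S])
  moreover have "Z \<bullet> (W ** Y) = (W ** Y) \<bullet> Z" "Y \<bullet> (W ** Z) = (W ** Y) \<bullet> Z"
    using inner_mult_left[of W Y Z] by (simp_all add: inner_commute ctW)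
  moreover have "Y \<bullet> (W ** Y) = (W ** Y) \<bullet> Y" by (rule inner_commute)
  ultimately have "2 * J (Suc l) + (Z - Y) \<bullet> (W ** (Z - Y)) \<le> 2 * J l"
    unfolding matrix_diff_ldistrib inner_diff_left inner_diff_right by linarith
  then show ?thesis by (simp only: W_def Y_def Z_def)
qed

text \<open>The weight is bounded below because the singular values are at most the nuclear norm,
  hence at most \<open>J l\<close>, and \<open>e\<close> is at most 1.\<close>

lemma J_progress: "2 * J (Suc l) + (norm (x (Suc l) - x (Suc (Suc l))))\<^sup>2 / (J l + 1) \<le> 2 * J l"
proof -
  obtain U d where dec: "left_singular_decomp (x (Suc l)) U d" by (rule left_singular_decomp_exists)
  have "inverse (J l + 1) \<le> inverse (max (d i) (e (Suc l)))" for i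
  proof (rule le_imp_inverse_le)
    have "d i \<le> nuclear_norm (x (Suc l))"
      unfolding nuclear_norm_eq[OF dec] using left_singular_decompD(2)[OF dec] by (intro member_le_sum) auto
    then show "max (d i) (e (Suc l)) \<le> J l + 1"
      using nuclear_norm_le_J[of l] e_le_1[of "Suc l"] J_nonneg[of l] by simp
    show "0 < max (d i) (e (Suc l))" using e_pos[of "Suc l"] by simp
  qed
  then have "inverse (J l + 1) * (norm (x (Suc l) - x (Suc (Suc l))))\<^sup>2
      \<le> (x (Suc l) - x (Suc (Suc l))) \<bullet> (w (Suc l) ** (x (Suc l) - x (Suc (Suc l))))"
    unfolding w_Suc irls_weight_eq[OF dec] by (rule unitary_diag_coercive[OF left_singular_decompD(1)[OF dec]])
  then show ?thesis using J_decrease[of l] by (simp add: divide_inverse mult.commute)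
qed

lemma J_decseq: "decseq J"
proof (rule decseq_SucI)
  fix l
  have "0 \<le> (norm (x (Suc l) - x (Suc (Suc l))))\<^sup>2 / (J l + 1)" using J_nonneg[of l] by simp
  then show "J (Suc l) \<le> J l" using J_progress[of l] by linarith
qed

lemma steps_vanish: "(\<lambda>l. norm (x (Suc l) - x (Suc (Suc l)))) \<longlonglongrightarrow> 0"
proof -
  obtain L where L: "J \<longlonglongrightarrow> L" using decseq_convergent[OF J_decseq, of 0] J_nonneg by blast
  then have "(\<lambda>l. 2 * (J l - J (Suc l)) * (J 0 + 1)) \<longlonglongrightarrow> 2 * (L - L) * (J 0 + 1)"
    by (intro tendsto_intros) (auto simp: LIMSEQ_Suc)
  then have lim: "(\<lambda>l. 2 * (J l - J (Suc l)) * (J 0 + 1)) \<longlonglongrightarrow> 0" by simp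
  have "(norm (x (Suc l) - x (Suc (Suc l))))\<^sup>2 \<le> 2 * (J l - J (Suc l)) * (J 0 + 1)" for l
  proof -
    have "(norm (x (Suc l) - x (Suc (Suc l))))\<^sup>2 / (J l + 1) \<le> 2 * (J l - J (Suc l))"
      using J_progress[of l] by simp
    then have "(norm (x (Suc l) - x (Suc (Suc l))))\<^sup>2 \<le> 2 * (J l - J (Suc l)) * (J l + 1)"
      using J_nonneg[of l] by (simp add: pos_divide_le_eq)
    also have "\<dots> \<le> 2 * (J l - J (Suc l)) * (J 0 + 1)"
      using decseqD[OF J_decseq, of 0 l] decseqD[OF J_decseq, of l "Suc l"] by (intro mult_left_mono) auto
    finally show ?thesis .
  qed
  then have "(\<lambda>l. (norm (x (Suc l) - x (Suc (Suc l))))\<^sup>2) \<longlonglongrightarrow> 0"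
    by (intro tendsto_sandwich[OF _ _ tendsto_const lim]) auto
  then have "(\<lambda>l. sqrt ((norm (x (Suc l) - x (Suc (Suc l))))\<^sup>2)) \<longlonglongrightarrow> sqrt 0"
    by (rule tendsto_real_sqrt)
  then show ?thesis by simp
qed

lemma convergence_if_e_vanishes:
  assumes e0: "e \<longlonglongrightarrow> 0" shows "x \<longlonglongrightarrow> X"
proof -
  obtain C where C: "0 \<le> C" "\<And>Z. S Z = M \<Longrightarrow> norm (Z - X) \<le> C * \<sigma> Z"
    using \<sigma>_controls_error by blast
  define D where "D = sqrt (real CARD('n)) * C * real CARD('n) + real CARD('n) / 2"
  \<comment> \<open>\<open>J l\<close> is at most its value at a step \<open>j\<close> no later than
    \<open>l\<close> with the same \<open>e\<close>, where \<sigma> is a multiple of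
    \<open>e\<close> and \<open>\<sigma>_controls_error\<close> applies. In \<open>D\<close>, the
    square root passes from the Frobenius to the nuclear norm and the last summand is the smoothing
    error.\<close>
  have J_le: "J l \<le> nuclear_norm X + D * e (Suc l)" if lt: "e (Suc l) < 1" for l
  proof -
    obtain j where j: "j \<le> l" "e (Suc j) = e (Suc l)" "\<sigma> (x (Suc j)) = real CARD('n) * e (Suc l)"
      using e_attained[of l] lt by auto
    define Z where "Z = x (Suc j)"
    have "J l \<le> J j" using decseqD[OF J_decseq j(1)] .
    also have "\<dots> \<le> nuclear_norm Z + real CARD('n) * e (Suc l) / 2"
      unfolding J_def j(2) Z_def by (rule smoothed_nuclear_norm_le[OF e_pos])
    also have "nuclear_norm Z \<le> nuclear_norm X + nuclear_norm (Z - X)"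
      using nuclear_norm_triangle[of X "Z - X"] by simp
    also have "nuclear_norm (Z - X) \<le> sqrt (real CARD('n)) * norm (Z - X)"
      using rank_le_CARD[of "Z - X"] by (intro order_trans[OF nuclear_norm_le_rank] mult_right_mono) auto
    also have "\<dots> \<le> sqrt (real CARD('n)) * (C * (real CARD('n) * e (Suc l)))"
      using C(2)[of Z] feasible[of j] j(3) by (intro mult_left_mono) (auto simp: Z_def)
    finally show ?thesis by (simp add: D_def algebra_simps)
  qed
  have e0': "(\<lambda>l. e (Suc l)) \<longlonglongrightarrow> 0" using e0 by (rule LIMSEQ_Suc)
  have "\<forall>\<^sub>F l in sequentially. e (Suc l) < 1" using e0' by (rule order_tendstoD) simp
  then have "\<forall>\<^sub>F l in sequentially. norm (x (Suc l) - X) \<le> \<kappa> * D * e (Suc l)"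
  proof eventually_elim
    case (elim l)
    have "nuclear_norm (x (Suc l)) - nuclear_norm X \<le> D * e (Suc l)"
      using J_le[OF elim] nuclear_norm_le_J[of l] by linarith
    then have "\<kappa> * (nuclear_norm (x (Suc l)) - nuclear_norm X) \<le> \<kappa> * (D * e (Suc l))"
      using \<kappa>_nonneg by (rule mult_left_mono)
    then show ?case using stability[OF feasible, of l] by simp
  qed
  moreover have "(\<lambda>l. \<kappa> * D * e (Suc l)) \<longlonglongrightarrow> 0" using tendsto_mult_right_zero[OF e0'] by simp
  ultimately have "(\<lambda>l. x (Suc l) - X) \<longlonglongrightarrow> 0" by (rule Lim_null_comparison)
  then have "(\<lambda>l. x (Suc l)) \<longlonglongrightarrow> X" by (rule LIM_zero_cancel)
  then show ?thesis by (rule LIMSEQ_imp_Suc)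
qed

text \<open>The subgradient at \<open>Z\<close> is \<open>W ** Z\<close>, while optimality makes
  \<open>W ** Y\<close> orthogonal to \<open>X - Z\<close>. Only the difference
  \<open>W ** (Z - Y)\<close> remains, and the norm of \<open>W\<close> is at most the inverse of
  \<open>e (Suc l)\<close>.\<close>

lemma J_almost_minimal:
  "J l \<le> smoothed_nuclear_norm (e (Suc l)) X
    + norm (x (Suc l) - x (Suc (Suc l))) / e (Suc l) * (norm X + J 0)"
proof -
  define W where "W = w (Suc l)"
  define Y where "Y = x (Suc (Suc l))"
  define Z where "Z = x (Suc l)"
  obtain U d where dec: "left_singular_decomp Z U d" by (rule left_singular_decomp_exists)
  have norm_W: "norm (W ** H) \<le> inverse (e (Suc l)) * norm H" for H :: "complex^'p^'n"
    unfolding W_def w_Suc Z_def[symmetric] irls_weight_eq[OF dec]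
    using e_pos[of "Suc l"]
    by (intro unitary_diag_norm_le[OF left_singular_decompD(1)[OF dec]] le_imp_inverse_le) (auto simp: le_max_iff_disj)
  have "(W ** Y) \<bullet> (X - Z) = 0"
    unfolding W_def Y_def Z_def using feasible X(2)
    by (intro minimizer(2)[OF e_pos]) (simp add: linear_diff[OF S])
  then have "- ((W ** Z) \<bullet> (X - Z)) = (W ** (Z - Y)) \<bullet> (Z - X)"
    by (simp add: matrix_diff_ldistrib inner_diff_left inner_diff_right)
  also have "\<dots> \<le> norm (W ** (Z - Y)) * norm (Z - X)" by (rule norm_cauchy_schwarz)
  also have "\<dots> \<le> (inverse (e (Suc l)) * norm (Z - Y)) * (norm X + J 0)"
  proof (rule mult_mono[OF norm_W])
    have "norm Z \<le> J 0"
      using nuclear_norm_ge_norm[of Z] nuclear_norm_le_J[of l] decseqD[OF J_decseq, of 0 l] by (simp add: Z_def)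
    then show "norm (Z - X) \<le> norm X + J 0" using norm_triangle_ineq4[of Z X] by linarith
  qed (use e_pos[of "Suc l"] in auto)
  also have "\<dots> = norm (Z - Y) / e (Suc l) * (norm X + J 0)" by (simp add: divide_inverse mult.commute)
  finally show ?thesis
    using smoothed_nuclear_norm_subgradient[OF e_pos[of "Suc l"] w_Suc[of l], of X]
    by (simp add: J_def W_def Y_def Z_def)
qed

lemma e_vanishes: "e \<longlonglongrightarrow> 0"
proof -
  obtain t where t: "e \<longlonglongrightarrow> t" "\<And>l. t \<le> e l"
    using decseq_convergent[of e 0] e_Suc_le e_nonneg by (metis decseq_SucI)
  have "0 \<le> t" using t(1) e_nonneg by (intro LIMSEQ_le_const) auto
  have "\<not> 0 < t"
  proof
    assume "0 < t"
    define D where "D = (norm X + J 0) / t"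
    have "0 \<le> D" using J_nonneg \<open>0 < t\<close> by (simp add: D_def)
    have "(\<lambda>l. norm (x (Suc l) - x (Suc (Suc l))) * D) \<longlonglongrightarrow> 0 * D"
      by (intro tendsto_intros steps_vanish)
    \<comment> \<open>The threshold uses up half of the allowance
      \<open>real CARD('n) * e (Suc l)\<close>, which \<open>e_le_\<sigma>\<close> bounds by
      \<sigma>; the other half is the smoothing error at \<open>X\<close>.\<close>
    then have "\<forall>\<^sub>F l in sequentially. norm (x (Suc l) - x (Suc (Suc l))) * D < real CARD('n) * t / 2"
      using n_pos \<open>0 < t\<close> by (intro order_tendstoD(2)) auto
    then obtain l where l: "norm (x (Suc l) - x (Suc (Suc l))) * D < real CARD('n) * t / 2"
      using eventually_happens'[OF sequentially_bot] by blast
    define Z where "Z = x (Suc l)"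
    have "norm (x (Suc l) - x (Suc (Suc l))) / e (Suc l) * (norm X + J 0)
        \<le> norm (x (Suc l) - x (Suc (Suc l))) / t * (norm X + J 0)"
      using t(2) \<open>0 < t\<close> J_nonneg[of 0] by (intro mult_right_mono divide_left_mono) (auto intro!: mult_pos_pos e_pos)
    also have "\<dots> = norm (x (Suc l) - x (Suc (Suc l))) * D" by (simp add: D_def)
    also have "\<dots> \<le> real CARD('n) * e (Suc l) / 2"
      using l mult_left_mono[OF t(2)[of "Suc l"], of "real CARD('n)"] n_pos by linarith
    finally have "J l \<le> smoothed_nuclear_norm (e (Suc l)) X + real CARD('n) * e (Suc l) / 2"
      using J_almost_minimal[of l] by linarith
    then have "nuclear_norm Z - nuclear_norm X \<le> real CARD('n) * e (Suc l)"
      using nuclear_norm_le_J[of l] smoothed_nuclear_norm_le[OF e_pos[of "Suc l"], of X] by (simp add: Z_def)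
    also have "\<dots> \<le> \<sigma> Z" unfolding Z_def by (rule e_le_\<sigma>)
    finally have "\<kappa> * (nuclear_norm Z - nuclear_norm X) \<le> \<kappa> * \<sigma> Z"
      using \<kappa>_nonneg by (rule mult_left_mono)
    then have "norm (Z - X) \<le> \<kappa> * \<sigma> Z"
      using stability[OF feasible[of l]] by (simp add: Z_def)
    then have "(norm (Z - X))\<^sup>2 \<le> \<kappa>\<^sup>2 * (\<sigma> Z)\<^sup>2"
      using power_mono[of "norm (Z - X)" "\<kappa> * \<sigma> Z" 2] by (simp add: power_mult_distrib)
    \<comment> \<open>Stability from above meets the Eckart-Young bound from below; cancelling the
      positive square of \<open>\<sigma> Z\<close> contradicts
      \<open>\<kappa>_bound\<close>.\<close>
    then have "(real K + 1 - real k) * (\<sigma> Z)\<^sup>2 \<le> \<kappa>\<^sup>2 * (\<sigma> Z)\<^sup>2"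
      using \<sigma>_lower_bound[of Z] by linarith
    moreover have "0 < \<sigma> Z"
      using e_le_\<sigma>[of l] mult_pos_pos[OF n_pos e_pos[of "Suc l"]] by (simp add: Z_def)
    ultimately show False using \<kappa>_bound by (simp add: mult_le_cancel_right)
  qed
  then show ?thesis using t(1) \<open>0 \<le> t\<close> by simp
qed

end

theorem irls_converges: "x \<longlonglongrightarrow> X"
proof (cases "\<exists>l. e l = 0")
  case True
  then show ?thesis using finite_termination by blast
next
  case False
  then have "0 < e l" for l using e_nonneg[of l] by (metis order_le_less)
  then show ?thesis using convergence_if_e_vanishes e_vanishes by blast
qed

end

theorem proposition2p1:
  fixes S :: "complex^'p^'n \<Rightarrow> complex^'m" and M :: "complex^'m"
    and X :: "complex^'p^'n" and K k :: nat and \<eta> :: real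
  assumes "K > 2" and "4 * K \<le> CARD('n)" and "CARD('n) \<le> CARD('p)"
    and "complex_linear S" and "surj S"
    and "ric S (3 * K) < 1"
    and "\<eta> = sqrt 2 * ric S (4 * K) / (1 - ric S (3 * K))"
    and "\<eta> < 1 - 2 / (real K - 2)"
    and "rank X \<le> k" and "S X = M"
    and "real k < real K - 2 * \<eta> / (1 - \<eta>)"
  shows "(\<lambda>l. irls_iterate S M K (1 / real CARD('n)) l) \<longlonglongrightarrow> X"
proof -
  interpret irls_recovery S M X K k \<eta>
    by (rule irls_recovery.intro; fact assms complex_linear_imp_linear[OF assms(4)])
  have "x = irls_iterate S M K (1 / real CARD('n))" by (simp add: fun_eq_iff x_def)
  then show ?thesis using irls_converges by simp
qed

end
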